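(* Suppose that $q$ is not a root of unity. Then $$\{\theta(T(P))\mid P\in \mathcal{H}\text{-}\mathrm{Spec}(\mathcal{O}_q(G(m,n)))\}=\mathcal{H}\text{-}\mathrm{Spec}(\mathcal{O}_q(G(m,n))),$$ where $T(P)=\{a'\mid a\in P\}\subseteq T(\mathcal{O}_q(G(m,n)))$ and $\theta:T(\mathcal{O}_q(G(m,n)))\to\mathcal{O}_q(G(m,n))$ is the $\mathbb{K}$-algebra isomorphism determined by $\theta([i_1,\dots,i_m]')=[i_1+1,\dots,i_m+1]$ for $1\le i_1<\dots<i_m<n$ and $\theta([i_1,\dots,i_{m-1},n]')=q^{-2}[1,i_1+1,\dots,i_{m-1}+1]$ for $1\le i_1<\dots<i_{m-1}<n$.
   Context: $\mathbb{K}$ is a field, $\mathbb{K}^*=\mathbb{K}\setminus\{0\}$, $q\in\mathbb{K}^*$, $m<n$ are positive integers, and $p\in\mathbb{K}$ is a fixed element with $p^m=q^2$. Quantum matrices: for positive integers $r,s$, $\mathcal{O}_q(M_{r,s})$ is the $\mathbb{K}$-algebra generated by $X_{ij}$ ($1\le i\le r$, $1\le j\le s$) subject to: $X_{ij}X_{il}=qX_{il}X_{ij}$ for $j<l$; $X_{ij}X_{kj}=qX_{kj}X_{ij}$ for $i<k$; $X_{ij}X_{kl}=X_{kl}X_{ij}$ for $k<i$, $j<l$; $X_{ij}X_{kl}-X_{kl}X_{ij}=(q-q^{-1})X_{il}X_{kj}$ for $i<k$, $j<l$. Quantum minors: for $I=\{i_1<\dots<i_t\}$, $J=\{j_1<\dots<j_t\}$,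 $[I|J]=\sum_{\sigma\in S_t}(-q)^{\ell(\sigma)}X_{i_{\sigma(1)}j_1}\cdots X_{i_{\sigma(t)}j_t}$, where $\ell$ is the Coxeter length. Quantum grassmannian: $\mathcal{O}_q(G(m,n))$ is the subalgebra of $\mathcal{O}_q(M_{m,n})$ generated by the $m\times m$ quantum minors $[J]=[j_1,\dots,j_m]:=[\{1,\dots,m\}|J]$, for $J=\{j_1<\dots<j_m\}\subseteq\{1,\dots,n\}$. It is $\mathbb{Z}^n$-graded with $[J]$ homogeneous of degree (content) $\sum_{j\in J}\epsilon(j)$, where $\epsilon(1),\dots,\epsilon(n)$ is the standard basis of $\mathbb{Z}^n$. Twist: $T(\mathcal{O}_q(G(m,n)))$ is the graded vector space isomorphic to $\mathcal{O}_q(G(m,n))$ via $a\mapsto a'$, with multiplication $a'b'=c(s,t)(ab)'$ for $a,b$ homogeneous of degrees $s,t$, where $c((s_1,\dots,s_n),(t_1,\dots,t_n))=\prod_{j\neq n}p^{s_nt_j}$ (a $2$-cocycle on $\mathbb{Z}^n$ with values in $\mathbb{K}^*$). The isomorphism $\theta$ described in the claim exists. $\mathcal{H}$-primes: the torus $\mathcal{H}=(\mathbb{K}^* )^n$ acts on $\mathcal{O}_q(G(m,n))$ by algebra automorphisms via $(h_1,\dots,h_n).[i_1,\dots,i_m]=h_{i_1}\cdots h_{i_m}[i_1,\dots,i_m]$. An $\mathcal{H}$-prime ideal is a prime ideal invariant under this action; equivalently, a prime ideal homogeneous for the $\mathbb{Z}^n$-grading. $\mathcal{H}\text{-}\mathrm{Spec}(\mathcal{O}_q(G(m,n)))$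 is the set of $\mathcal{H}$-prime ideals. *)

theory Defs
  imports
    "HOL-Library.Poly_Mapping"
    "HOL-Combinatorics.Permutations"
    "HOL-Algebra.QuotRing"
    "HOL-Algebra.Ideal_Product"
    "HOL-Algebra.Subrings"
    "HOL-Algebra.Algebraic_Closure_Type"
begin

section \<open>Algebras over a field\<close>

text \<open>
  An associative unital algebra over the field \<open>'k\<close> is a record of type \<^typ>\<open>('k, 'a) module\<close>.
  (The locale \<open>algebra\<close> of HOL-Algebra assumes commutativity and is not applicable.)
  The field itself, viewed as a record, is \<^const>\<open>ring_of_type_algebra\<close>.
\<close>

abbreviation scalars :: "'k::field ring" where
  "scalars \<equiv> ring_of_type_algebra"

definition lin_span :: "('k::field, 'a) module \<Rightarrow> 'a set \<Rightarrow> 'a set" where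
  "lin_span A S = \<Inter>{V. submodule V scalars A \<and> S \<subseteq> V}"

definition alg_generate :: "('k::field, 'a) module \<Rightarrow> 'a set \<Rightarrow> 'a set" where
  "alg_generate A S = \<Inter>{B. subring B A \<and> submodule B scalars A \<and> S \<subseteq> B}"

definition alg_iso :: "('k::field, 'a) module \<Rightarrow> ('k, 'b) module \<Rightarrow> ('a \<Rightarrow> 'b) set" where
  "alg_iso A B = {\<phi> \<in> ring_iso A B. \<forall>c. \<forall>a\<in>carrier A. \<phi> (c \<odot>\<^bsub>A\<^esub> a) = c \<odot>\<^bsub>B\<^esub> \<phi> a}"

definition alg_quot :: "('k::field, 'a) module \<Rightarrow> 'a set \<Rightarrow> ('k, 'a set) module" where
  "alg_quot A I =
    \<lparr>carrier = carrier (A Quot I),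
     monoid.mult = monoid.mult (A Quot I),
     one = \<one>\<^bsub>A Quot I\<^esub>,
     zero = \<zero>\<^bsub>A Quot I\<^esub>,
     add = add (A Quot I),
     module.smult = (\<lambda>c C. \<Union>a\<in>C. I +>\<^bsub>A\<^esub> (c \<odot>\<^bsub>A\<^esub> a))\<rparr>"

text \<open>
  Prime ideals of a not necessarily commutative ring; the locale \<open>primeideal\<close> of HOL-Algebra is
  restricted to commutative rings and uses the elementwise condition.
\<close>

definition prime_ideal :: "'a set \<Rightarrow> ('a, 'm) ring_scheme \<Rightarrow> bool" where
  "prime_ideal P R \<longleftrightarrow> ideal P R \<and> P \<noteq> carrier R \<and>
    (\<forall>I J. ideal I R \<longrightarrow> ideal J R \<longrightarrow> ideal_prod R I J \<subseteq> P \<longrightarrow> I \<subseteq> P \<or> J \<subseteq> P)"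


section \<open>Free algebras\<close>

datatype 'x word = Word (letters: "'x list")

instantiation word :: (type) monoid_add
begin

definition zero_word :: "'x word" where
  "zero_word = Word []"

definition plus_word :: "'x word \<Rightarrow> 'x word \<Rightarrow> 'x word" where
  "plus_word u v = Word (letters u @ letters v)"

instance
  by standard (simp_all add: zero_word_def plus_word_def)

end

text \<open>
  With words added by concatenation, the ring \<^typ>\<open>'x word \<Rightarrow>\<^sub>0 'k\<close> is the monoid algebra of the
  free monoid on \<open>'x\<close>. The free algebra on a set \<open>S\<close> of letters consists of the
  linear combinations of words in \<open>S\<close>.
\<close>

definition fconst :: "'k::field \<Rightarrow> ('x word \<Rightarrow>\<^sub>0 'k)" where
  "fconst c = Poly_Mapping.single 0 c"

definition free_alg :: "'x set \<Rightarrow> ('k::field, 'x word \<Rightarrow>\<^sub>0 'k) module" where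
  "free_alg S =
    \<lparr>carrier = {f. \<forall>w\<in>Poly_Mapping.keys f. set (letters w) \<subseteq> S},
     monoid.mult = (*), one = 1, zero = 0, add = (+),
     module.smult = (\<lambda>c f. fconst c * f)\<rparr>"


section \<open>Quantum matrices\<close>

definition qgen :: "nat \<Rightarrow> nat \<Rightarrow> ((nat \<times> nat) word \<Rightarrow>\<^sub>0 'k::field)" where
  "qgen i j = Poly_Mapping.single (Word [(i, j)]) 1"

abbreviation matrix_letters :: "nat \<Rightarrow> nat \<Rightarrow> (nat \<times> nat) set" where
  "matrix_letters r s \<equiv> {1..r} \<times> {1..s}"

definition qmatrix_relators ::
  "'k::field \<Rightarrow> nat \<Rightarrow> nat \<Rightarrow> ((nat \<times> nat) word \<Rightarrow>\<^sub>0 'k) set" where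
  "qmatrix_relators q r s =
     {qgen i j * qgen i l - fconst q * qgen i l * qgen i j | i j l.
        i \<in> {1..r} \<and> j \<in> {1..s} \<and> l \<in> {1..s} \<and> j < l}
   \<union> {qgen i j * qgen k j - fconst q * qgen k j * qgen i j | i j k.
        i \<in> {1..r} \<and> k \<in> {1..r} \<and> j \<in> {1..s} \<and> i < k}
   \<union> {qgen i j * qgen k l - qgen k l * qgen i j | i j k l.
        i \<in> {1..r} \<and> k \<in> {1..r} \<and> j \<in> {1..s} \<and> l \<in> {1..s} \<and> k < i \<and> j < l}
   \<union> {qgen i j * qgen k l - qgen k l * qgen i j - fconst (q - inverse q) * qgen i l * qgen k j | i j k l.
        i \<in> {1..r} \<and> k \<in> {1..r} \<and> j \<in> {1..s} \<and> l \<in> {1..s} \<and> i < k \<and> j < l}"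

text \<open>Elements of the algebra of quantum matrices are cosets in the free algebra.\<close>

type_synonym 'k qmat = "((nat \<times> nat) word \<Rightarrow>\<^sub>0 'k) set"

definition qmatrix_ideal :: "'k::field \<Rightarrow> nat \<Rightarrow> nat \<Rightarrow> ((nat \<times> nat) word \<Rightarrow>\<^sub>0 'k) set" where
  "qmatrix_ideal q r s = genideal (free_alg (matrix_letters r s)) (qmatrix_relators q r s)"

definition qmatrices :: "'k::field \<Rightarrow> nat \<Rightarrow> nat \<Rightarrow> ('k, 'k qmat) module" where
  "qmatrices q r s = alg_quot (free_alg (matrix_letters r s)) (qmatrix_ideal q r s)"

text \<open>Coxeter length on the permutations of \<open>{..<t}\<close>: word length in adjacent transpositions.\<close>

definition coxeter_length :: "nat \<Rightarrow> (nat \<Rightarrow> nat) \<Rightarrow> nat" where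
  "coxeter_length t \<sigma> = (LEAST k. \<exists>xs. length xs = k \<and> (\<forall>i\<in>set xs. Suc i < t) \<and>
     \<sigma> = foldr (\<circ>) (map (\<lambda>i. Transposition.transpose i (Suc i)) xs) id)"

text \<open>
  The quantum minor \<open>[I|J]\<close>, for \<open>I\<close> and \<open>J\<close> of the same size. Row and column indices are listed in
  increasing order and numbered from \<open>0\<close>; the minor is the class of the displayed element of the
  free algebra.
\<close>

definition qminor :: "'k::field \<Rightarrow> nat \<Rightarrow> nat \<Rightarrow> nat set \<Rightarrow> nat set \<Rightarrow> 'k qmat" where
  "qminor q r s I J =
    (let t = card I; i = (\<lambda>k. sorted_list_of_set I ! k); j = (\<lambda>k. sorted_list_of_set J ! k) in
     qmatrix_ideal q r s +>\<^bsub>free_alg (matrix_letters r s)\<^esub>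
       (\<Sum>\<sigma> | \<sigma> permutes {..<t}.
          fconst ((- q) ^ coxeter_length t \<sigma>) *
          prod_list (map (\<lambda>k. qgen (i (\<sigma> k)) (j k)) [0..<t])))"


section \<open>The quantum grassmannian\<close>

definition index_sets :: "nat \<Rightarrow> nat \<Rightarrow> nat set set" where
  "index_sets m n = {J. J \<subseteq> {1..n} \<and> card J = m}"

definition maxminor :: "'k::field \<Rightarrow> nat \<Rightarrow> nat \<Rightarrow> nat set \<Rightarrow> 'k qmat" where
  "maxminor q m n J = qminor q m n {1..m} J"

definition qgrassmannian :: "'k::field \<Rightarrow> nat \<Rightarrow> nat \<Rightarrow> ('k, 'k qmat) module" where
  "qgrassmannian q m n =
    (qmatrices q m n)
      \<lparr>carrier := alg_generate (qmatrices q m n) (maxminor q m n ` index_sets m n)\<rparr>"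

text \<open>
  \<open>\<int>\<^sup>n\<close> is embedded in \<^typ>\<open>nat \<Rightarrow>\<^sub>0 int\<close> as the functions supported on \<open>{1..n}\<close>. The component of
  degree \<open>s\<close> is spanned by the products of generators whose contents add up to \<open>s\<close>; it is zero if
  \<open>s\<close> is not supported on \<open>{1..n}\<close>.
\<close>

definition grass_content :: "nat set \<Rightarrow> (nat \<Rightarrow>\<^sub>0 int)" where
  "grass_content J = (\<Sum>j\<in>J. Poly_Mapping.single j 1)"

definition qgrass_grading ::
  "'k::field \<Rightarrow> nat \<Rightarrow> nat \<Rightarrow> (nat \<Rightarrow>\<^sub>0 int) \<Rightarrow> 'k qmat set" where
  "qgrass_grading q m n s = lin_span (qgrassmannian q m n)
     {foldr (\<otimes>\<^bsub>qgrassmannian q m n\<^esub>) (map (maxminor q m n) Js) \<one>\<^bsub>qgrassmannian q m n\<^esub> | Js.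
        set Js \<subseteq> index_sets m n \<and> sum_list (map grass_content Js) = s}"


section \<open>Twisting\<close>

text \<open>The unique decomposition of \<open>a\<close> into homogeneous elements for the grading \<open>\<Gamma>\<close>.\<close>

definition homog_parts :: "('k::field, 'a) module \<Rightarrow> ('d \<Rightarrow> 'a set) \<Rightarrow> 'a \<Rightarrow> 'd \<Rightarrow> 'a" where
  "homog_parts A \<Gamma> a = (THE f. (\<forall>s. f s \<in> \<Gamma> s) \<and> finite {s. f s \<noteq> \<zero>\<^bsub>A\<^esub>} \<and>
     a = finsum A f {s. f s \<noteq> \<zero>\<^bsub>A\<^esub>})"

text \<open>The copy \<open>a \<mapsto> a'\<close> of the underlying space; the constructor \<open>Tw\<close> is the prime.\<close>

datatype 'a twisted = Tw (untw: 'a)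

definition twist ::
  "('d \<Rightarrow> 'd \<Rightarrow> 'k::field) \<Rightarrow> ('k, 'a) module \<Rightarrow> ('d \<Rightarrow> 'a set) \<Rightarrow> ('k, 'a twisted) module" where
  "twist c A \<Gamma> =
    \<lparr>carrier = Tw ` carrier A,
     monoid.mult = (\<lambda>x y.
       let f = homog_parts A \<Gamma> (untw x); g = homog_parts A \<Gamma> (untw y) in
       Tw (finsum A (\<lambda>s. finsum A (\<lambda>t. c s t \<odot>\<^bsub>A\<^esub> (f s \<otimes>\<^bsub>A\<^esub> g t)) {t. g t \<noteq> \<zero>\<^bsub>A\<^esub>})
             {s. f s \<noteq> \<zero>\<^bsub>A\<^esub>})),
     one = Tw \<one>\<^bsub>A\<^esub>,
     zero = Tw \<zero>\<^bsub>A\<^esub>,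
     add = (\<lambda>x y. Tw (untw x \<oplus>\<^bsub>A\<^esub> untw y)),
     module.smult = (\<lambda>k x. Tw (k \<odot>\<^bsub>A\<^esub> untw x))\<rparr>"

definition grass_cocycle ::
  "'k::field \<Rightarrow> nat \<Rightarrow> (nat \<Rightarrow>\<^sub>0 int) \<Rightarrow> (nat \<Rightarrow>\<^sub>0 int) \<Rightarrow> 'k" where
  "grass_cocycle p n s t =
    (\<Prod>j\<in>{1..n} - {n}. p powi (Poly_Mapping.lookup s n * Poly_Mapping.lookup t j))"

definition twisted_qgrassmannian ::
  "'k::field \<Rightarrow> 'k \<Rightarrow> nat \<Rightarrow> nat \<Rightarrow> ('k, 'k qmat twisted) module" where
  "twisted_qgrassmannian p q m n =
    twist (grass_cocycle p n) (qgrassmannian q m n) (qgrass_grading q m n)"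


section \<open>Torus action and \<open>\<H>\<close>-primes\<close>

text \<open>Only the values of \<open>h\<close> on \<open>{1..n}\<close> matter.\<close>

definition torus :: "nat \<Rightarrow> (nat \<Rightarrow> 'k::field) set" where
  "torus n = {h. \<forall>j\<in>{1..n}. h j \<noteq> 0}"

definition torus_act ::
  "'k::field \<Rightarrow> nat \<Rightarrow> nat \<Rightarrow> (nat \<Rightarrow> 'k) \<Rightarrow> 'k qmat \<Rightarrow> 'k qmat" where
  "torus_act q m n h = (THE \<phi>.
     \<phi> \<in> extensional (carrier (qgrassmannian q m n)) \<and>
     \<phi> \<in> alg_iso (qgrassmannian q m n) (qgrassmannian q m n) \<and>
     (\<forall>J\<in>index_sets m n.
        \<phi> (maxminor q m n J) = (\<Prod>j\<in>J. h j) \<odot>\<^bsub>qgrassmannian q m n\<^esub> maxminor q m n J))"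

definition HSpec :: "'k::field \<Rightarrow> nat \<Rightarrow> nat \<Rightarrow> 'k qmat set set" where
  "HSpec q m n = {P. prime_ideal P (qgrassmannian q m n) \<and>
     (\<forall>h\<in>torus n. torus_act q m n h ` P = P)}"

end

theory Submission
  imports Defs
begin

text \<open>
  As \<open>q\<close> has infinite order, the characters of the torus separate the degrees in \<open>\<int>\<^sup>n\<close>, so a
  torus-invariant ideal is the same as a homogeneous ideal. Over a linearly ordered group of degrees,
  whether a homogeneous ideal is prime can be tested on homogeneous elements \<open>a\<close>, \<open>r\<close>, \<open>b\<close>, by
  comparing leading terms. On homogeneous elements the twisted product and the original product
  differ only by nonzero scalars, hence \<open>P\<close> and \<open>T(P)\<close> are prime simultaneously. Finally \<open>\<theta>\<close>
  permutes the homogeneous components, rotating \<open>{1..n}\<close> cyclically, so it carries homogeneous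
  primes to homogeneous primes, and so does its inverse.
\<close>

section \<open>Algebras and generated substructures\<close>

text \<open>The twisted algebra is kept out of the ideal theory; it is never shown to be a ring.
  Composing \<open>\<theta>\<close> with \<open>Tw\<close> gives a linear bijection
  \<open>\<psi>\<close> of the grassmannian with \<open>\<psi> a \<otimes> \<psi> b = c s t \<odot>
  \<psi> (a \<otimes> b)\<close> for homogeneous \<open>a\<close>, \<open>b\<close>. Since
  \<open>\<psi>\<close> is not multiplicative, every transport step has to be reduced to homogeneous
  elements. The other obstacle is the grading itself. Its components are defined as spans of
  products of minors, and their independence is not visible from the definition, since the minors
  satisfy relations of their own. It is imported instead: words of the free algebra are graded by
  their columns, the relators of quantum matrices are homogeneous for this grading, so it descends
  to the quotient, and each term of a maximal minor uses every column of \<open>J\<close> once. The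
  relation \<open>p ^ m = q ^ 2\<close> enters through \<open>p \<noteq> 0\<close>, which makes the
  values of the cocycle invertible.\<close>

locale kalgebra = ring A for A :: "('k::field, 'a) module" (structure) +
  assumes smult_closed [simp, intro]: "x \<in> carrier A \<Longrightarrow> c \<odot> x \<in> carrier A"
    and smult_add_left: "x \<in> carrier A \<Longrightarrow> (c + d) \<odot> x = c \<odot> x \<oplus> d \<odot> x"
    and smult_add: "x \<in> carrier A \<Longrightarrow> y \<in> carrier A \<Longrightarrow> c \<odot> (x \<oplus> y) = c \<odot> x \<oplus> c \<odot> y"
    and smult_smult: "x \<in> carrier A \<Longrightarrow> c \<odot> (d \<odot> x) = (c * d) \<odot> x"
    and smult_one [simp]: "x \<in> carrier A \<Longrightarrow> 1 \<odot> x = x"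
    and smult_mult_left: "x \<in> carrier A \<Longrightarrow> y \<in> carrier A \<Longrightarrow> (c \<odot> x) \<otimes> y = c \<odot> (x \<otimes> y)"
    and smult_mult_right: "x \<in> carrier A \<Longrightarrow> y \<in> carrier A \<Longrightarrow> x \<otimes> (c \<odot> y) = c \<odot> (x \<otimes> y)"
begin

lemma zero_smult [simp]: "x \<in> carrier A \<Longrightarrow> 0 \<odot> x = \<zero>"
proof -
  assume x: "x \<in> carrier A"
  have "0 \<odot> x = 0 \<odot> x \<oplus> 0 \<odot> x"
    using smult_add_left[OF x, of 0 0] by simp
  then show ?thesis using x by (metis add.r_cancel_one' smult_closed)
qed

lemma smult_zero [simp]: "c \<odot> \<zero> = \<zero>"
  by (metis mult_zero_right smult_smult zero_closed zero_smult)

lemma smult_minus_one: "x \<in> carrier A \<Longrightarrow> (- 1) \<odot> x = \<ominus> x"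
proof -
  assume x: "x \<in> carrier A"
  have "(- 1) \<odot> x \<oplus> 1 \<odot> x = \<zero>"
    using smult_add_left[OF x, of "-1" 1] x by simp
  then show ?thesis using x by (metis minus_equality smult_closed smult_one)
qed

lemma smult_cancel: "x \<in> carrier A \<Longrightarrow> c \<noteq> 0 \<Longrightarrow> inverse c \<odot> (c \<odot> x) = x"
  by (simp add: smult_smult)

lemma finsum_smult:
  "finite T \<Longrightarrow> f \<in> T \<rightarrow> carrier A \<Longrightarrow> c \<odot> finsum A f T = finsum A (\<lambda>i. c \<odot> f i) T"
  by (induction T rule: finite_induct) (auto simp: smult_add Pi_def)

text \<open>Closure under negation comes from the scalar \<open>- 1\<close>, which leaves four
  elementary clauses to check for every subspace built below.\<close>

lemma submodule_iff:
  "submodule V scalars A \<longleftrightarrow> V \<subseteq> carrier A \<and> \<zero> \<in> V \<and> (\<forall>x\<in>V. \<forall>y\<in>V. x \<oplus> y \<in> V) \<and>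
     (\<forall>c. \<forall>x\<in>V. c \<odot> x \<in> V)" (is "?l \<longleftrightarrow> ?r")
proof
  assume ?l
  then interpret submodule V scalars A .
  show ?r
    using subset one_closed m_closed smult_closed by (auto simp: ring_of_type_algebra_def)
next
  assume r: ?r
  show ?l
  proof (rule submodule.intro)
    show "subgroup V (add_monoid A)"
    proof (rule add.subgroupI)
      show "V \<subseteq> carrier A" "V \<noteq> {}" using r by auto
      fix x assume "x \<in> V"
      with r have "(- 1) \<odot> x \<in> V" "x \<in> carrier A" by auto
      then show "\<ominus> x \<in> V" by (simp add: smult_minus_one)
    qed (use r in auto)
    show "submodule_axioms V scalars A"
      using r by (simp add: submodule_axioms_def)
  qed
qed

lemma submodule_smult: "submodule V scalars A \<Longrightarrow> x \<in> V \<Longrightarrow> c \<odot> x \<in> V"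
  by (simp add: submodule_iff)

lemma submodule_finsum:
  assumes V: "submodule V scalars A" and f: "\<And>i. i \<in> T \<Longrightarrow> f i \<in> V"
  shows "finsum A f T \<in> V"
  using f
proof (induction T rule: infinite_finite_induct)
  case (insert i T)
  then have "f i \<in> carrier A" "f \<in> T \<rightarrow> carrier A" 
    using V by (auto simp: submodule_iff)
  then show ?case using insert V by (auto simp: submodule_iff)
qed (use V in \<open>auto simp: submodule_iff\<close>)

text \<open>Scaling by \<open>c\<close> is multiplication by the ring element
  \<open>c \<odot> \<one>\<close>, which an ideal absorbs.\<close>

lemma ideal_submodule:
  assumes "ideal I A"
  shows "submodule I scalars A"
proof -
  interpret I: ideal I A by fact
  have "c \<odot> x \<in> I" if "x \<in> I" for c x
    using I.I_l_closed[OF that, of "c \<odot> \<one>"] I.Icarr[OF that] by (simp add: smult_mult_left)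
  then show ?thesis
    using I.Icarr I.zero_closed I.a_closed by (auto simp: submodule_iff)
qed

lemma idealI_submodule:
  assumes V: "submodule V scalars A"
    and "\<And>x a. x \<in> carrier A \<Longrightarrow> a \<in> V \<Longrightarrow> x \<otimes> a \<in> V"
    and "\<And>x a. x \<in> carrier A \<Longrightarrow> a \<in> V \<Longrightarrow> a \<otimes> x \<in> V"
  shows "ideal V A"
  using assms submodule.axioms(1)[OF V] by (intro idealI) (auto simp: ring_axioms)

lemma submodule_Inter:
  assumes "\<And>V. V \<in> F \<Longrightarrow> submodule V scalars A" "F \<noteq> {}"
  shows "submodule (\<Inter>F) scalars A"
  using assms unfolding submodule_iff by (auto; blast)

lemma submodule_carrier: "submodule (carrier A) scalars A"
  by (simp add: submodule_iff)

section \<open>Spans and generated subalgebras\<close>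

lemma lin_span_submodule: "S \<subseteq> carrier A \<Longrightarrow> submodule (lin_span A S) scalars A"
  unfolding lin_span_def by (rule submodule_Inter) (use submodule_carrier in auto)

lemma lin_span_superset: "S \<subseteq> lin_span A S"
  by (auto simp: lin_span_def)

lemma lin_span_least: "submodule V scalars A \<Longrightarrow> S \<subseteq> V \<Longrightarrow> lin_span A S \<subseteq> V"
  by (auto simp: lin_span_def)

lemma alg_generate_subring: "S \<subseteq> carrier A \<Longrightarrow> subring (alg_generate A S) A"
  unfolding alg_generate_def
  by (rule subring_Inter) (use submodule_carrier carrier_is_subring in auto)

lemma alg_generate_submodule: "S \<subseteq> carrier A \<Longrightarrow> submodule (alg_generate A S) scalars A"
  unfolding alg_generate_def
  by (rule submodule_Inter) (use submodule_carrier carrier_is_subring in auto)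

lemma alg_generate_superset: "S \<subseteq> alg_generate A S"
  by (auto simp: alg_generate_def)

lemma alg_generate_least:
  "subring B A \<Longrightarrow> submodule B scalars A \<Longrightarrow> S \<subseteq> B \<Longrightarrow> alg_generate A S \<subseteq> B"
  by (auto simp: alg_generate_def)

lemma kalgebra_subalgebra:
  assumes "subring B A" "submodule B scalars A"
  shows "kalgebra (A\<lparr>carrier := B\<rparr>)"
proof -
  interpret B: ring "A\<lparr>carrier := B\<rparr>" using subring_is_ring[OF assms(1)] .
  have "B \<subseteq> carrier A" using assms(2) by (simp add: submodule_iff)
  then show ?thesis
    using assms(2)
    by unfold_locales
      (auto simp: submodule_iff subset_iff smult_add_left smult_add smult_smult smult_mult_left smult_mult_right)
qed

end


section \<open>Graded algebras\<close>

text \<open>The degrees carry a linear order compatible with addition so that leading terms exist;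
  on \<open>nat \<Rightarrow>\<^sub>0 int\<close> it is the lexicographic one.
  \<open>comp_exists\<close> provides a total family vanishing off a finite set, the form of
  decomposition that \<open>homog_parts\<close> selects.\<close>

locale graded_algebra = kalgebra A for A :: "('k::field, 'a) module" (structure) +
  fixes \<Gamma> :: "'d::linordered_ab_group_add \<Rightarrow> 'a set"
  assumes comp_submodule: "submodule (\<Gamma> s) scalars A"
    and comp_one: "\<one> \<in> \<Gamma> 0"
    and comp_mult: "a \<in> \<Gamma> s \<Longrightarrow> b \<in> \<Gamma> t \<Longrightarrow> a \<otimes> b \<in> \<Gamma> (s + t)"
    and comp_exists: "a \<in> carrier A \<Longrightarrow>
      \<exists>f T. finite T \<and> (\<forall>s. f s \<in> \<Gamma> s) \<and> (\<forall>s. s \<notin> T \<longrightarrow> f s = \<zero>) \<and> a = finsum A f T"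
    and comp_indep: "finite T \<Longrightarrow> \<forall>s. f s \<in> \<Gamma> s \<Longrightarrow> finsum A f T = \<zero> \<Longrightarrow> s \<in> T \<Longrightarrow> f s = \<zero>"
begin

lemma comp_carrier [simp, intro]: "a \<in> \<Gamma> s \<Longrightarrow> a \<in> carrier A"
  using comp_submodule[of s] by (auto simp: submodule_iff)

lemma comp_zero [simp, intro]: "\<zero> \<in> \<Gamma> s"
  using comp_submodule[of s] by (auto simp: submodule_iff)

lemma comp_add [simp, intro]: "a \<in> \<Gamma> s \<Longrightarrow> b \<in> \<Gamma> s \<Longrightarrow> a \<oplus> b \<in> \<Gamma> s"
  using comp_submodule[of s] by (auto simp: submodule_iff)

lemma comp_smult [simp, intro]: "a \<in> \<Gamma> s \<Longrightarrow> c \<odot> a \<in> \<Gamma> s"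
  using comp_submodule[of s] by (auto simp: submodule_iff)

text \<open>The property under the \<open>THE\<close> of \<open>homog_parts\<close>. That operator
  is meaningful only once existence and uniqueness are known, so the predicate takes its place until
  \<open>decomp_parts\<close>.\<close>

definition decomp :: "('d \<Rightarrow> 'a) \<Rightarrow> 'a \<Rightarrow> bool" where
  "decomp f a \<longleftrightarrow> (\<forall>s. f s \<in> \<Gamma> s) \<and> finite {s. f s \<noteq> \<zero>} \<and> a = finsum A f {s. f s \<noteq> \<zero>}"

text \<open>Supports change under addition. Freeing the sum from the exact support lets two
  decompositions be added over a common finite set.\<close>

lemma decomp_finsum:
  assumes "decomp f a" "finite T" "\<And>s. s \<notin> T \<Longrightarrow> f s = \<zero>"
  shows "a = finsum A f T"
proof -
  have "finsum A f {s. f s \<noteq> \<zero>} = finsum A f T"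
    using assms by (intro add.finprod_mono_neutral_cong_left) (auto simp: decomp_def)
  then show ?thesis using assms by (simp add: decomp_def)
qed

lemma decompI:
  assumes "finite T" "\<And>s. f s \<in> \<Gamma> s" "\<And>s. s \<notin> T \<Longrightarrow> f s = \<zero>" "a = finsum A f T"
  shows "decomp f a"
proof -
  have sub: "{s. f s \<noteq> \<zero>} \<subseteq> T" using assms by auto
  have "finsum A f {s. f s \<noteq> \<zero>} = finsum A f T"
    using assms sub by (intro add.finprod_mono_neutral_cong_left) auto
  then show ?thesis using assms finite_subset[OF sub] by (simp add: decomp_def)
qed

lemma decomp_add:
  assumes "decomp f a" "decomp g b"
  shows "decomp (\<lambda>s. f s \<oplus> g s) (a \<oplus> b)"
proof -
  let ?T = "{s. f s \<noteq> \<zero>} \<union> {s. g s \<noteq> \<zero>}"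
  have fin: "finite ?T" and mem: "\<And>s. f s \<in> \<Gamma> s" "\<And>s. g s \<in> \<Gamma> s"
    using assms by (auto simp: decomp_def)
  show ?thesis
  proof (rule decompI[OF fin])
    show "a \<oplus> b = finsum A (\<lambda>s. f s \<oplus> g s) ?T"
      using decomp_finsum[OF assms(1) fin] decomp_finsum[OF assms(2) fin] mem
      by (subst finsum_addf) auto
  qed (use mem in auto)
qed

lemma decomp_smult:
  assumes "decomp f a"
  shows "decomp (\<lambda>s. c \<odot> f s) (c \<odot> a)"
proof (rule decompI)
  show "finite {s. f s \<noteq> \<zero>}" using assms by (auto simp: decomp_def)
  then show "c \<odot> a = finsum A (\<lambda>s. c \<odot> f s) {s. f s \<noteq> \<zero>}"
    using assms by (subst finsum_smult[symmetric]) (auto simp: decomp_def)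
qed (use assms in \<open>auto simp: decomp_def\<close>)

lemma decomp_zero_unique:
  assumes "decomp f \<zero>"
  shows "f s = \<zero>"
  using comp_indep[of "{s. f s \<noteq> \<zero>}" f s] assms by (auto simp: decomp_def)

lemma decomp_carrier: "decomp f a \<Longrightarrow> a \<in> carrier A"
  by (auto simp: decomp_def intro!: finsum_closed)

text \<open>The difference of two decompositions of \<open>a\<close> decomposes
  \<open>\<zero>\<close>, where \<open>comp_indep\<close> applies.\<close>

lemma decomp_unique:
  assumes "decomp f a" "decomp g a"
  shows "f = g"
proof
  fix s
  have a: "a \<in> carrier A" using assms decomp_carrier by auto
  have "decomp (\<lambda>s. f s \<oplus> (- 1) \<odot> g s) (a \<oplus> (- 1) \<odot> a)"
    by (rule decomp_add[OF assms(1) decomp_smult[OF assms(2)]])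
  then have "decomp (\<lambda>s. f s \<oplus> (- 1) \<odot> g s) \<zero>"
    using a by (simp add: smult_minus_one r_neg)
  then have "f s \<oplus> (- 1) \<odot> g s = \<zero>" by (rule decomp_zero_unique)
  moreover have "f s \<in> carrier A" "g s \<in> carrier A" using assms by (auto simp: decomp_def)
  ultimately show "f s = g s" by (simp add: smult_minus_one r_right_minus_eq[unfolded a_minus_def])
qed

section \<open>Component maps and the convolution formula\<close>

abbreviation parts :: "'a \<Rightarrow> 'd \<Rightarrow> 'a" where
  "parts \<equiv> homog_parts A \<Gamma>"

lemma parts_eqI:
  assumes "decomp f a" shows "parts a = f"
  unfolding homog_parts_def
  using assms decomp_unique[OF _ assms] by (intro the_equality) (auto simp: decomp_def)

lemma decomp_parts:
  assumes "a \<in> carrier A" shows "decomp (parts a) a"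
proof -
  from comp_exists[OF assms] obtain f T where
    "finite T" "\<forall>s. f s \<in> \<Gamma> s" "\<forall>s. s \<notin> T \<longrightarrow> f s = \<zero>" "a = finsum A f T" by blast
  then have "decomp f a" by (intro decompI) auto
  then show ?thesis using parts_eqI by simp
qed

lemma parts_comp [simp, intro]: "a \<in> carrier A \<Longrightarrow> parts a s \<in> \<Gamma> s"
  and finite_parts [simp, intro]: "a \<in> carrier A \<Longrightarrow> finite {s. parts a s \<noteq> \<zero>}"
  and finsum_parts: "a \<in> carrier A \<Longrightarrow> a = finsum A (parts a) {s. parts a s \<noteq> \<zero>}"
  using decomp_parts by (auto simp: decomp_def)

lemma parts_carrier [simp, intro]: "a \<in> carrier A \<Longrightarrow> parts a s \<in> carrier A"
  by blast

lemma parts_add: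
  "a \<in> carrier A \<Longrightarrow> b \<in> carrier A \<Longrightarrow> parts (a \<oplus> b) = (\<lambda>s. parts a s \<oplus> parts b s)"
  by (intro parts_eqI decomp_add decomp_parts)

lemma parts_smult: "a \<in> carrier A \<Longrightarrow> parts (c \<odot> a) = (\<lambda>s. c \<odot> parts a s)"
  by (intro parts_eqI decomp_smult decomp_parts)

lemma parts_homog: "a \<in> \<Gamma> s \<Longrightarrow> parts a = (\<lambda>u. if u = s then a else \<zero>)"
  by (intro parts_eqI decompI[of "{s}"]) auto

lemma parts_zero [simp]: "parts \<zero> s = \<zero>"
  by (simp add: parts_homog[OF comp_zero[of s]])

lemma parts_finsum:
  "finite T \<Longrightarrow> f \<in> T \<rightarrow> carrier A \<Longrightarrow> parts (finsum A f T) s = finsum A (\<lambda>i. parts (f i) s) T"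
  by (induction T rule: finite_induct) (auto simp: Pi_def parts_add)

lemma eq_partsI:
  "a \<in> carrier A \<Longrightarrow> b \<in> carrier A \<Longrightarrow> (\<And>s. parts a s = parts b s) \<Longrightarrow> a = b"
  by (metis finsum_parts ext)

text \<open>The homogeneous case concerns the components of the given \<open>a\<close> alone, so
  their degrees are available through \<open>parts_comp\<close>.\<close>

lemma homog_induct [consumes 1, case_names zero homog add]:
  assumes "a \<in> carrier A" and "Q \<zero>" and "\<And>s. Q (parts a s)"
    and "\<And>x y. x \<in> carrier A \<Longrightarrow> y \<in> carrier A \<Longrightarrow> Q x \<Longrightarrow> Q y \<Longrightarrow> Q (x \<oplus> y)"
  shows "Q a"
proof -
  have "Q (finsum A (parts a) T)" if "finite T" for T
    using that by (induction T rule: finite_induct) (auto simp: Pi_def assms intro!: assms(4))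
  then show ?thesis using finsum_parts[OF assms(1)] finite_parts[OF assms(1)] by metis
qed

lemma parts_homog_mult_left:
  assumes "a \<in> \<Gamma> s" "b \<in> carrier A"
  shows "parts (a \<otimes> b) u = a \<otimes> parts b (u - s)"
  using assms(2)
proof (induction b rule: homog_induct)
  case zero show ?case using assms by auto
next
  case (homog t)
  have "a \<otimes> parts b t \<in> \<Gamma> (s + t)" using assms comp_mult by auto
  from parts_homog[OF this] show ?case
    using assms by (auto simp: parts_homog[OF parts_comp[OF assms(2)]] algebra_simps)
next
  case (add x y)
  then show ?case using assms by (auto simp: parts_add r_distr)
qed

text \<open>Expanding the left factor is enough: for a homogeneous left factor of degree
  \<open>s\<close>, degree \<open>u\<close> of the product sees just the component of
  \<open>b\<close> in degree \<open>u - s\<close>. This gives one finite sum over the support of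
  \<open>a\<close>.\<close>

lemma parts_mult:
  assumes a: "a \<in> carrier A" and b: "b \<in> carrier A"
  shows "parts (a \<otimes> b) u = finsum A (\<lambda>s. parts a s \<otimes> parts b (u - s)) {s. parts a s \<noteq> \<zero>}"
proof -
  let ?T = "{s. parts a s \<noteq> \<zero>}"
  have "a \<otimes> b = finsum A (parts a) ?T \<otimes> b" using finsum_parts[OF a] by simp
  also have "\<dots> = finsum A (\<lambda>s. parts a s \<otimes> b) ?T"
    using a b by (intro finsum_ldistr) auto
  finally show ?thesis
    using a b by (simp add: parts_finsum Pi_def parts_homog_mult_left[OF parts_comp])
qed

definition homogeneous :: "'a set \<Rightarrow> bool" where
  "homogeneous P \<longleftrightarrow> (\<forall>a\<in>P. \<forall>s. parts a s \<in> P)"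

subsection \<open>Homogeneous prime ideals\<close>

text \<open>
  Two ideals \<open>I\<close> and \<open>J\<close> with \<open>a \<in> I\<close>, \<open>b \<in> J\<close> and \<open>I J \<subseteq> P\<close> that need no description of
  two-sided principal ideals.
\<close>

lemma prime_ideal_elementwise:
  assumes P: "prime_ideal P A" and a: "a \<in> carrier A" and b: "b \<in> carrier A"
    and ab: "\<And>r. r \<in> carrier A \<Longrightarrow> a \<otimes> r \<otimes> b \<in> P"
  shows "a \<in> P \<or> b \<in> P"
proof -
  interpret P: ideal P A using P by (simp add: prime_ideal_def)
  have sub: "submodule P scalars A" by (rule ideal_submodule) (rule P.is_ideal)
  \<comment> \<open>\<open>J\<close> is the right annihilator of \<open>I\<close> modulo
    \<open>P\<close>, so \<open>I J\<close> lies in \<open>P\<close> by construction. It absorbs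
    multiplication on the left because \<open>I\<close> absorbs multiplication on the right.\<close>
  define I where "I = {x \<in> carrier A. \<forall>r\<in>carrier A. x \<otimes> r \<otimes> b \<in> P}"
  define J where "J = {y \<in> carrier A. \<forall>x\<in>I. x \<otimes> y \<in> P}"
  have Ic: "x \<in> carrier A" if "x \<in> I" for x using that by (simp add: I_def)
  have I: "ideal I A"
  proof (rule idealI_submodule)
    show "submodule I scalars A"
      using sub b by (auto simp: submodule_iff I_def l_distr smult_mult_left)
  next
    fix x c assume xc: "x \<in> carrier A" "c \<in> I"
    then have c: "c \<in> carrier A" "\<And>r. r \<in> carrier A \<Longrightarrow> c \<otimes> r \<otimes> b \<in> P"
      by (auto simp: I_def)
    have "x \<otimes> c \<otimes> r \<otimes> b \<in> P" if r: "r \<in> carrier A" for r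
      using P.I_l_closed[OF c(2)[OF r] xc(1)] xc c(1) r b by (simp add: m_assoc)
    then show "x \<otimes> c \<in> I" using xc c(1) by (auto simp: I_def)
    have "c \<otimes> x \<otimes> r \<otimes> b \<in> P" if r: "r \<in> carrier A" for r
      using c(2)[of "x \<otimes> r"] xc c(1) r b by (simp add: m_assoc)
    then show "c \<otimes> x \<in> I" using xc c(1) by (auto simp: I_def)
  qed
  interpret I: ideal I A by fact
  have J: "ideal J A"
  proof (rule idealI_submodule)
    show "submodule J scalars A"
      using sub Ic by (auto simp: submodule_iff J_def r_distr smult_mult_right)
  next
    fix x c assume xc: "x \<in> carrier A" "c \<in> J"
    then have c: "c \<in> carrier A" "\<And>i. i \<in> I \<Longrightarrow> i \<otimes> c \<in> P" by (auto simp: J_def)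
    have "i \<otimes> (x \<otimes> c) \<in> P" if i: "i \<in> I" for i
      using c(2)[OF I.I_r_closed[OF i xc(1)]] xc c(1) Ic[OF i] by (simp add: m_assoc)
    then show "x \<otimes> c \<in> J" using xc c(1) by (auto simp: J_def)
    have "i \<otimes> (c \<otimes> x) \<in> P" if i: "i \<in> I" for i
      using P.I_r_closed[OF c(2)[OF i] xc(1)] xc c(1) Ic[OF i] by (simp add: m_assoc)
    then show "c \<otimes> x \<in> J" using xc c(1) by (auto simp: J_def)
  qed
  have "ideal_prod A I J \<subseteq> P"
  proof
    fix z assume "z \<in> ideal_prod A I J"
    then show "z \<in> P" by induction (auto simp: J_def)
  qed
  then have "I \<subseteq> P \<or> J \<subseteq> P" using P I J by (simp add: prime_ideal_def)
  moreover have "a \<in> I" unfolding I_def using a ab by blast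
  \<comment> \<open>The choice \<open>r = \<one>\<close> in the definition of \<open>I\<close>
    yields \<open>b \<in> J\<close>.\<close>
  moreover have "x \<otimes> b \<in> P" if "x \<in> I" for x
  proof -
    have "x \<otimes> \<one> \<otimes> b \<in> P" using that one_closed unfolding I_def by blast
    then show ?thesis using Ic[OF that] by simp
  qed
  with b have "b \<in> J" unfolding J_def by blast
  ultimately show ?thesis by blast
qed

text \<open>
  The leading-term argument: look at the largest degrees in which \<open>a\<close> and \<open>b\<close> have a component
  outside \<open>P\<close>.
\<close>

lemma prime_ideal_homogI:
  assumes P: "ideal P A" and hom: "homogeneous P" and proper: "P \<noteq> carrier A"
    and prime: "\<And>s t a b. a \<in> \<Gamma> s \<Longrightarrow> b \<in> \<Gamma> t \<Longrightarrow>
      (\<And>u r. r \<in> \<Gamma> u \<Longrightarrow> a \<otimes> r \<otimes> b \<in> P) \<Longrightarrow> a \<in> P \<or> b \<in> P"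
  shows "prime_ideal P A"
  unfolding prime_ideal_def
proof (intro conjI allI impI)
  fix I J assume I: "ideal I A" and J: "ideal J A" and IJ: "ideal_prod A I J \<subseteq> P"
  interpret P: ideal P A by fact
  interpret I: ideal I A by fact
  interpret J: ideal J A by fact
  have sub: "submodule P scalars A" by (rule ideal_submodule[OF P])
  \<comment> \<open>Components outside \<open>P\<close> are nonzero, hence finite in number; at
    least one exists because \<open>P\<close> is closed under sums and \<open>a\<close> is the sum
    of its components.\<close>
  have top: "\<exists>s. parts a s \<notin> P \<and> (\<forall>s'>s. parts a s' \<in> P)" if a: "a \<in> carrier A" "a \<notin> P" for a
  proof -
    let ?S = "{s. parts a s \<notin> P}"
    have "?S \<subseteq> {s. parts a s \<noteq> \<zero>}" using P.zero_closed by auto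
    then have fin: "finite ?S" using a finite_subset by blast
    have "?S \<noteq> {}"
    proof
      assume "?S = {}"
      then have "finsum A (parts a) {s. parts a s \<noteq> \<zero>} \<in> P"
        by (intro submodule_finsum[OF sub]) auto
      with a finsum_parts[OF a(1)] show False by simp
    qed
    with fin have "Max ?S \<in> ?S" by (rule Max_in)
    moreover have "s' \<notin> ?S" if "s' > Max ?S" for s'
      using Max_ge[OF fin, of s'] that leD by blast
    ultimately show ?thesis by blast
  qed
  show "I \<subseteq> P \<or> J \<subseteq> P"
  proof (rule ccontr)
    assume "\<not> ?thesis"
    then obtain a b where a: "a \<in> I" "a \<notin> P" and b: "b \<in> J" "b \<notin> P" by blast
    have ac: "a \<in> carrier A" and bc: "b \<in> carrier A" using a b I.Icarr J.Icarr by auto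
    from top[OF ac a(2)] obtain s where s: "parts a s \<notin> P" "\<And>s'. s' > s \<Longrightarrow> parts a s' \<in> P"
      by blast
    from top[OF bc b(2)] obtain t where t: "parts b t \<notin> P" "\<And>t'. t' > t \<Longrightarrow> parts b t' \<in> P"
      by blast
    have "parts a s \<otimes> r \<otimes> parts b t \<in> P" if r: "r \<in> \<Gamma> u" for u r
    proof -
      have rc: "r \<in> carrier A" using r by auto
      have "a \<otimes> (r \<otimes> b) \<in> P"
        using IJ ideal_prod.prod[OF a(1) J.I_l_closed[OF b(1) rc]] by blast
      \<comment> \<open>As \<open>r\<close> has the single degree \<open>u\<close>, this component
        is the sum over \<open>s'\<close> of the products of \<open>parts a s'\<close>,
        \<open>r\<close> and \<open>parts b (s + t - s')\<close>. For \<open>s' > s\<close> the left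
        factor lies in \<open>P\<close>; for \<open>s' < s\<close> the right factor has degree above
        \<open>t\<close> and lies in \<open>P\<close>. So the term at \<open>s' = s\<close> lies in
        \<open>P\<close> as well.\<close>
      then have "parts (a \<otimes> (r \<otimes> b)) (s + u + t) \<in> P"
        using hom by (simp add: homogeneous_def)
      moreover define f where "f = (\<lambda>s'. parts a s' \<otimes> (r \<otimes> parts b (s + t - s')))"
      moreover define T where "T = {s. parts a s \<noteq> \<zero>}"
      moreover have "s + u + t - s' - u = s + t - s'" for s' by (simp add: algebra_simps)
      ultimately have sum: "finsum A f T \<in> P"
        by (simp add: parts_mult[OF ac] rc bc parts_homog_mult_left[OF r])
      have fin: "finite T" using ac by (auto simp: T_def)
      have sT: "s \<in> T" using s(1) P.zero_closed by (auto simp: T_def)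
      have fc: "f s' \<in> carrier A" for s' using ac bc rc by (simp add: f_def)
      have fP: "f s' \<in> P" if "s' \<noteq> s" for s'
      proof (cases "s' > s")
        case True
        then show ?thesis unfolding f_def using s(2) rc bc by (intro P.I_r_closed) auto
      next
        case False
        then have "s + t - s' > t" using that by (auto simp: algebra_simps)
        then show ?thesis unfolding f_def using t(2) rc ac by (intro P.I_l_closed) auto
      qed
      have "finsum A f (insert s (T - {s})) = f s \<oplus> finsum A f (T - {s})"
        using fin fc by (intro finsum_insert) auto
      moreover have "finsum A f (T - {s}) \<in> P"
        using fP by (intro submodule_finsum[OF sub]) auto
      ultimately have "f s \<oplus> finsum A f (T - {s}) \<in> P" "finsum A f (T - {s}) \<in> P"
        using sum sT by (auto simp: insert_absorb)
      then have "f s \<in> P"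
        using fc P.a_closed[OF _ P.a_inv_closed]
        by (metis P.Icarr add.inv_solve_right' add.inv_closed a_closed minus_eq)
      then show ?thesis using ac bc rc by (simp add: f_def m_assoc)
    qed
    then have "parts a s \<in> P \<or> parts b t \<in> P"
      by (rule prime[OF parts_comp[OF ac] parts_comp[OF bc]])
    with s(1) t(1) show False by blast
  qed
qed (use assms in auto)

text \<open>For fixed \<open>a\<close> and \<open>b\<close> the condition is additive in
  \<open>r\<close>, so homogeneous \<open>r\<close> decide it for all \<open>r\<close>. In this form
  the condition can be carried along maps that are multiplicative only up to scalars on homogeneous
  elements.\<close>

lemma prime_ideal_homogD:
  assumes P: "prime_ideal P A" and a: "a \<in> carrier A" and b: "b \<in> carrier A"
    and ab: "\<And>u r. r \<in> \<Gamma> u \<Longrightarrow> a \<otimes> r \<otimes> b \<in> P"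
  shows "a \<in> P \<or> b \<in> P"
proof (rule prime_ideal_elementwise[OF P a b])
  interpret P: ideal P A using P by (simp add: prime_ideal_def)
  fix r assume r: "r \<in> carrier A"
  then show "a \<otimes> r \<otimes> b \<in> P"
  proof (induction r rule: homog_induct)
    case zero
    then show ?case using a b P.zero_closed by simp
  next
    case (homog s)
    show ?case by (rule ab[OF parts_comp[OF r]])
  next
    case (add x y)
    then show ?case using a b P.a_closed by (simp add: l_distr r_distr)
  qed
qed

subsection \<open>Rescaling the homogeneous components\<close>

text \<open>The diagonal operator with weights \<open>\<chi>\<close>. It is linear for arbitrary
  weights; when \<open>\<chi>\<close> is a character of the degree group with nonzero values it is
  an algebra automorphism, and the torus acts in this way.\<close>

definition rescale :: "('d \<Rightarrow> 'k) \<Rightarrow> 'a \<Rightarrow> 'a" where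
  "rescale \<chi> a = finsum A (\<lambda>s. \<chi> s \<odot> parts a s) {s. parts a s \<noteq> \<zero>}"

lemma decomp_rescale:
  assumes "a \<in> carrier A"
  shows "decomp (\<lambda>s. \<chi> s \<odot> parts a s) (rescale \<chi> a)"
  unfolding rescale_def using assms by (intro decompI) auto

lemma rescale_closed [simp, intro]: "a \<in> carrier A \<Longrightarrow> rescale \<chi> a \<in> carrier A"
  using decomp_rescale decomp_carrier by blast

lemma parts_rescale: "a \<in> carrier A \<Longrightarrow> parts (rescale \<chi> a) s = \<chi> s \<odot> parts a s"
  using parts_eqI[OF decomp_rescale] by simp

lemma rescale_homog: "a \<in> \<Gamma> s \<Longrightarrow> rescale \<chi> a = \<chi> s \<odot> a"
  by (rule eq_partsI) (auto simp: parts_rescale parts_smult parts_homog)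

lemma rescale_rescale:
  "a \<in> carrier A \<Longrightarrow> rescale \<chi> (rescale \<omega> a) = rescale (\<lambda>s. \<chi> s * \<omega> s) a"
  by (rule eq_partsI) (auto simp: parts_rescale smult_smult)

lemma rescale_id: "a \<in> carrier A \<Longrightarrow> (\<And>s. \<chi> s = 1) \<Longrightarrow> rescale \<chi> a = a"
  by (rule eq_partsI) (auto simp: parts_rescale)

lemma rescale_add:
  "a \<in> carrier A \<Longrightarrow> b \<in> carrier A \<Longrightarrow> rescale \<chi> (a \<oplus> b) = rescale \<chi> a \<oplus> rescale \<chi> b"
  by (rule eq_partsI) (auto simp: parts_rescale parts_add smult_add)

lemma rescale_smult: "a \<in> carrier A \<Longrightarrow> rescale \<chi> (c \<odot> a) = c \<odot> rescale \<chi> a"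
  by (rule eq_partsI) (auto simp: parts_rescale parts_smult smult_smult mult.commute)

lemma rescale_mult:
  assumes \<chi>: "\<And>s t. \<chi> (s + t) = \<chi> s * \<chi> t" and nz: "\<And>s. \<chi> s \<noteq> 0"
    and a: "a \<in> carrier A" and b: "b \<in> carrier A"
  shows "rescale \<chi> (a \<otimes> b) = rescale \<chi> a \<otimes> rescale \<chi> b"
proof (rule eq_partsI)
  fix u
  let ?T = "{s. parts a s \<noteq> \<zero>}"
  \<comment> \<open>No weight vanishes, so both products expand over the same support and the
    convolution sums can be compared term by term.\<close>
  have T: "{s. \<chi> s \<odot> parts a s \<noteq> \<zero>} = ?T"
    using a nz smult_cancel by (metis (no_types, lifting) parts_carrier smult_zero)
  have "parts (rescale \<chi> (a \<otimes> b)) u = \<chi> u \<odot> finsum A (\<lambda>s. parts a s \<otimes> parts b (u - s)) ?T"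
    using a b by (simp add: parts_rescale parts_mult)
  also have "\<dots> = finsum A (\<lambda>s. \<chi> u \<odot> (parts a s \<otimes> parts b (u - s))) ?T"
    using a b by (intro finsum_smult) auto
  also have "\<dots> = finsum A (\<lambda>s. (\<chi> s \<odot> parts a s) \<otimes> (\<chi> (u - s) \<odot> parts b (u - s))) ?T"
  proof (rule finsum_cong')
    fix s
    have "\<chi> u = \<chi> s * \<chi> (u - s)" using \<chi>[of s "u - s"] by simp
    then show "\<chi> u \<odot> (parts a s \<otimes> parts b (u - s)) =
        (\<chi> s \<odot> parts a s) \<otimes> (\<chi> (u - s) \<odot> parts b (u - s))"
      using a b by (simp add: smult_mult_left smult_mult_right smult_smult mult.commute)
  qed (use a b in auto)
  also have "\<dots> = parts (rescale \<chi> a \<otimes> rescale \<chi> b) u"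
    using a b T by (simp add: parts_rescale parts_mult)
  finally show "parts (rescale \<chi> (a \<otimes> b)) u = parts (rescale \<chi> a \<otimes> rescale \<chi> b) u" .
qed (use a b in auto)

lemma rescale_bij:
  assumes "\<And>s. \<chi> s \<noteq> 0"
  shows "bij_betw (rescale \<chi>) (carrier A) (carrier A)"
  by (rule bij_betw_byWitness[where f' = "rescale (\<lambda>s. inverse (\<chi> s))"])
    (auto simp: rescale_rescale rescale_id assms)

lemma rescale_alg_iso:
  assumes "\<And>s t. \<chi> (s + t) = \<chi> s * \<chi> t" and "\<And>s. \<chi> s \<noteq> 0"
  shows "rescale \<chi> \<in> alg_iso A A"
proof -
  have "\<chi> 0 * \<chi> 0 = \<chi> 0" using assms(1)[of 0 0] by simp
  then have "\<chi> 0 = 1" using assms(2)[of 0] by simp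
  then have "rescale \<chi> \<one> = \<one>" by (simp add: rescale_homog[OF comp_one])
  then show ?thesis
    unfolding alg_iso_def ring_iso_def ring_hom_def
    using rescale_bij[of \<chi>] assms by (auto simp: rescale_mult rescale_add rescale_smult)
qed

text \<open>Components of elements of \<open>P\<close> may be reweighted freely inside
  \<open>P\<close>; using the inverse weights as well turns the inclusion into an equality.\<close>

lemma rescale_homogeneous:
  assumes P: "submodule P scalars A" and hom: "homogeneous P" and nz: "\<And>s. \<chi> s \<noteq> 0"
  shows "rescale \<chi> ` P = P"
proof -
  have Pc: "a \<in> carrier A" if "a \<in> P" for a using that P by (auto simp: submodule_iff)
  have sub: "rescale \<omega> a \<in> P" if "a \<in> P" for \<omega> a
    unfolding rescale_def
    using that hom by (intro submodule_finsum[OF P] submodule_smult[OF P]) (auto simp: homogeneous_def)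
  have "a \<in> rescale \<chi> ` P" if "a \<in> P" for a
    using sub[OF that, of "\<lambda>s. inverse (\<chi> s)"] rescale_rescale[OF Pc[OF that], of \<chi> "\<lambda>s. inverse (\<chi> s)"]
    by (auto simp: rescale_id[OF Pc[OF that]] nz intro!: image_eqI)
  then show ?thesis using sub by auto
qed

text \<open>
  If \<open>a\<close> has components in the degrees \<open>s \<noteq> t\<close> and \<open>\<chi>\<close> separates them, then \<open>rescale \<chi> a - \<chi> t \<cdot> a\<close>
  has a smaller support that still contains \<open>s\<close>.
\<close>

lemma homogeneous_rescale:
  assumes P: "submodule P scalars A"
    and inv: "\<And>\<chi>. \<chi> \<in> H \<Longrightarrow> rescale \<chi> ` P \<subseteq> P"
    and sep: "\<And>s t a b. a \<in> \<Gamma> s \<Longrightarrow> b \<in> \<Gamma> t \<Longrightarrow> a \<noteq> \<zero> \<Longrightarrow> b \<noteq> \<zero> \<Longrightarrow> s \<noteq> t \<Longrightarrow>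
      \<exists>\<chi>\<in>H. \<chi> s \<noteq> \<chi> t"
  shows "homogeneous P"
proof -
  have Pc: "a \<in> carrier A" if "a \<in> P" for a using that P by (auto simp: submodule_iff)
  have Padd: "a \<oplus> b \<in> P" if "a \<in> P" "b \<in> P" for a b using that P by (auto simp: submodule_iff)
  have "\<forall>s. parts a s \<in> P" if "a \<in> P" for a
    using that
  proof (induction "card {s. parts a s \<noteq> \<zero>}" arbitrary: a rule: less_induct)
    case less
    have ac: "a \<in> carrier A" using less Pc by auto
    show ?case
    proof
      fix s
      show "parts a s \<in> P"
      proof (cases "\<exists>t. t \<noteq> s \<and> parts a t \<noteq> \<zero> \<and> parts a s \<noteq> \<zero>")
        case True
        then obtain t where t: "t \<noteq> s" "parts a t \<noteq> \<zero>" "parts a s \<noteq> \<zero>" by blast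
        obtain \<chi> where \<chi>: "\<chi> \<in> H" "\<chi> s \<noteq> \<chi> t"
          using sep[OF parts_comp[OF ac] parts_comp[OF ac] t(3,2)] t(1) by auto
        define b where "b = rescale \<chi> a \<oplus> (- \<chi> t) \<odot> a"
        have "b \<in> P"
          unfolding b_def using inv[OF \<chi>(1)] less(2) by (intro Padd submodule_smult[OF P]) auto
        have pb: "parts b u = (\<chi> u - \<chi> t) \<odot> parts a u" for u
          using ac smult_add_left[of "parts a u" "\<chi> u" "- \<chi> t"]
          by (simp add: b_def parts_add parts_rescale parts_smult)
        have "parts b t = \<zero>" using ac by (simp add: pb)
        moreover have "parts b u = \<zero>" if "parts a u = \<zero>" for u using that by (simp add: pb)
        ultimately have "{u. parts b u \<noteq> \<zero>} \<subset> {u. parts a u \<noteq> \<zero>}" using t(2) by auto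
        then have "card {u. parts b u \<noteq> \<zero>} < card {u. parts a u \<noteq> \<zero>}"
          using ac by (intro psubset_card_mono) auto
        from less(1)[OF this \<open>b \<in> P\<close>] have "(\<chi> s - \<chi> t) \<odot> parts a s \<in> P"
          by (simp add: pb)
        then have "inverse (\<chi> s - \<chi> t) \<odot> ((\<chi> s - \<chi> t) \<odot> parts a s) \<in> P"
          by (rule submodule_smult[OF P])
        then show ?thesis using \<chi>(2) ac by (simp add: smult_cancel)
      next
        case False
        show ?thesis
        proof (cases "parts a s = \<zero>")
          case True
          then show ?thesis using P by (simp add: submodule_iff)
        next
          case nz: False
          \<comment> \<open>No second degree occurs in \<open>a\<close>, so \<open>a\<close>
            coincides with its component in degree \<open>s\<close>.\<close>
          have "a = finsum A (parts a) {s}"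
            using False nz by (intro decomp_finsum[OF decomp_parts[OF ac]]) auto
          then have "a = parts a s" using ac by simp
          then show ?thesis using less(2) by simp
        qed
      qed
    qed
  qed
  then show ?thesis by (simp add: homogeneous_def)
qed

end

subsection \<open>Twisted automorphisms\<close>

text \<open>A model of the map sending \<open>a\<close> to the image under \<open>\<theta>\<close>
  of its primed copy: the twisted product survives as the factor \<open>c s t\<close>, and both
  sides of every equation live in the untwisted algebra.\<close>

locale twisted_automorphism = graded_algebra A \<Gamma>
  for A :: "('k::field, 'a) module" (structure)
    and \<Gamma> :: "'d::linordered_ab_group_add \<Rightarrow> 'a set" +
  fixes \<psi> :: "'a \<Rightarrow> 'a" and \<sigma> :: "'d \<Rightarrow> 'd" and c :: "'d \<Rightarrow> 'd \<Rightarrow> 'k"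
  assumes psi_bij: "bij_betw \<psi> (carrier A) (carrier A)"
    and psi_add: "a \<in> carrier A \<Longrightarrow> b \<in> carrier A \<Longrightarrow> \<psi> (a \<oplus> b) = \<psi> a \<oplus> \<psi> b"
    and psi_smult: "a \<in> carrier A \<Longrightarrow> \<psi> (k \<odot> a) = k \<odot> \<psi> a"
    and psi_comp: "a \<in> \<Gamma> s \<Longrightarrow> \<psi> a \<in> \<Gamma> (\<sigma> s)"
    and bij_degree: "bij \<sigma>"
    and nonzero: "c s t \<noteq> 0"
    and psi_mult: "a \<in> \<Gamma> s \<Longrightarrow> b \<in> \<Gamma> t \<Longrightarrow> \<psi> a \<otimes> \<psi> b = c s t \<odot> \<psi> (a \<otimes> b)"
begin

lemma psi_closed [simp, intro]: "a \<in> carrier A \<Longrightarrow> \<psi> a \<in> carrier A"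
  using psi_bij by (auto simp: bij_betw_def)

lemma psi_inj: "a \<in> carrier A \<Longrightarrow> b \<in> carrier A \<Longrightarrow> \<psi> a = \<psi> b \<Longrightarrow> a = b"
  using psi_bij by (auto simp: bij_betw_def inj_on_def)

lemma psi_zero [simp]: "\<psi> \<zero> = \<zero>"
  using psi_smult[of \<zero> 0] by simp

text \<open>Injectivity of \<open>\<sigma>\<close> keeps the images of different components in
  different degrees.\<close>

lemma parts_image: 
  assumes "a \<in> carrier A" shows "parts (\<psi> a) (\<sigma> s) = \<psi> (parts a s)"
  using assms
proof (induction a rule: homog_induct)
  case (homog t)
  have "inj \<sigma>" using bij_degree by (simp add: bij_is_inj)
  then show ?case
    using parts_homog[OF psi_comp[OF parts_comp[OF assms]]] parts_homog[OF parts_comp[OF assms]]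
    by (auto simp: inj_eq)
qed (auto simp: parts_add psi_add)

text \<open>\<open>psi_comp\<close> gives an inclusion between components. Equality follows by
  cutting an arbitrary preimage of \<open>y\<close> down to its component in the degree that
  \<open>\<sigma>\<close> sends to \<open>t\<close>.\<close>

lemma homog_preimage:
  assumes "y \<in> \<Gamma> t"
  shows "\<exists>a\<in>\<Gamma> (inv_into UNIV \<sigma> t). \<psi> a = y"
proof -
  obtain a where a: "a \<in> carrier A" "\<psi> a = y"
    using psi_bij comp_carrier[OF assms] by (metis bij_betw_imp_surj_on imageE)
  have "\<psi> (parts a (inv_into UNIV \<sigma> t)) = y"
    using parts_image[OF a(1), of "inv_into UNIV \<sigma> t"] a(2) bij_degree
    by (simp add: parts_homog[OF assms] bij_is_surj surj_f_inv_f)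
  then show ?thesis using a parts_comp by blast
qed

lemma image_submodule:
  assumes "submodule P scalars A"
  shows "submodule (\<psi> ` P) scalars A"
proof -
  have P: "P \<subseteq> carrier A" "\<zero> \<in> P" "\<And>x y. x \<in> P \<Longrightarrow> y \<in> P \<Longrightarrow> x \<oplus> y \<in> P"
    "\<And>k x. x \<in> P \<Longrightarrow> k \<odot> x \<in> P"
    using assms by (auto simp: submodule_iff)
  show ?thesis
    unfolding submodule_iff
  proof (intro conjI ballI allI)
    show "\<psi> ` P \<subseteq> carrier A" using P by auto
    show "\<zero> \<in> \<psi> ` P" using P(2) psi_zero by (metis image_eqI)
  next
    fix x y assume "x \<in> \<psi> ` P" "y \<in> \<psi> ` P"
    then show "x \<oplus> y \<in> \<psi> ` P"
      using P by (auto simp flip: psi_add simp: subset_iff)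
  next
    fix k x assume "x \<in> \<psi> ` P"
    then show "k \<odot> x \<in> \<psi> ` P"
      using P by (auto simp flip: psi_smult simp: subset_iff)
  qed
qed

lemma image_homogeneous:
  assumes "P \<subseteq> carrier A" "homogeneous P"
  shows "homogeneous (\<psi> ` P)"
  unfolding homogeneous_def
proof (intro ballI allI)
  fix y t assume "y \<in> \<psi> ` P"
  then obtain a where a: "a \<in> P" "y = \<psi> a" by blast
  have "parts y (\<sigma> (inv_into UNIV \<sigma> t)) = \<psi> (parts a (inv_into UNIV \<sigma> t))"
    using a assms parts_image by auto
  moreover have "parts a (inv_into UNIV \<sigma> t) \<in> P" using assms a by (simp add: homogeneous_def)
  ultimately show "parts y t \<in> \<psi> ` P"
    using bij_degree by (simp add: bij_is_surj surj_f_inv_f)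
qed

text \<open>Absorption cannot be pulled back along \<open>\<psi>\<close> directly, because
  \<open>\<psi>\<close> respects products only for homogeneous factors and up to a scalar.
  Homogeneity of \<open>P\<close> keeps the components of an element of \<open>P\<close> inside
  \<open>P\<close>, so it suffices to treat pairs of components.\<close>

lemma image_ideal:
  assumes P: "ideal P A" and hom: "homogeneous P"
  shows "ideal (\<psi> ` P) A"
proof (rule idealI_submodule)
  interpret P: ideal P A by fact
  show sub: "submodule (\<psi> ` P) scalars A" by (rule image_submodule[OF ideal_submodule[OF P]])
  fix x y assume x: "x \<in> carrier A" and y: "y \<in> \<psi> ` P"
  then obtain a where a: "a \<in> P" "y = \<psi> a" by blast
  have ac: "a \<in> carrier A" using a P.Icarr by auto
  obtain b where b: "b \<in> carrier A" "x = \<psi> b" using x psi_bij by (auto simp: bij_betw_def)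
  have zP: "\<zero> \<in> \<psi> ` P" and addP: "\<And>u v. u \<in> \<psi> ` P \<Longrightarrow> v \<in> \<psi> ` P \<Longrightarrow> u \<oplus> v \<in> \<psi> ` P"
    using sub by (auto simp: submodule_iff)
  have 1: "\<psi> (parts b s) \<otimes> \<psi> (parts a t) \<in> \<psi> ` P" "\<psi> (parts a t) \<otimes> \<psi> (parts b s) \<in> \<psi> ` P" for s t
  proof -
    have at: "parts a t \<in> P" using hom a by (simp add: homogeneous_def)
    have "parts b s \<otimes> parts a t \<in> P" "parts a t \<otimes> parts b s \<in> P"
      using P.I_l_closed[OF at] P.I_r_closed[OF at] b by auto
    then show "\<psi> (parts b s) \<otimes> \<psi> (parts a t) \<in> \<psi> ` P" "\<psi> (parts a t) \<otimes> \<psi> (parts b s) \<in> \<psi> ` P"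
      using psi_mult[OF parts_comp[OF b(1)] parts_comp[OF ac]]
        psi_mult[OF parts_comp[OF ac] parts_comp[OF b(1)]] submodule_smult[OF sub]
      by auto
  qed
  \<comment> \<open>Absorption extends by additivity, to the full \<open>b\<close> here and to the
    full \<open>a\<close> afterwards.\<close>
  have 2: "\<psi> b \<otimes> \<psi> (parts a t) \<in> \<psi> ` P \<and> \<psi> (parts a t) \<otimes> \<psi> b \<in> \<psi> ` P" for t
    using b(1)
  proof (induction b rule: homog_induct)
    case zero
    then show ?case using ac zP by simp
  next
    case (homog s)
    then show ?case using 1 by simp
  next
    case (add x y)
    then show ?case using ac addP by (simp add: psi_add l_distr r_distr)
  qed
  have "\<psi> b \<otimes> \<psi> a \<in> \<psi> ` P \<and> \<psi> a \<otimes> \<psi> b \<in> \<psi> ` P"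
    using ac
  proof (induction a rule: homog_induct)
    case zero
    then show ?case using b zP by simp
  next
    case (homog s)
    then show ?case using 2 by simp
  next
    case (add x y)
    then show ?case using b addP by (simp add: psi_add l_distr r_distr)
  qed
  then show "x \<otimes> y \<in> \<psi> ` P" "y \<otimes> x \<in> \<psi> ` P" using a b by auto
qed

lemma mem_image_iff: "P \<subseteq> carrier A \<Longrightarrow> a \<in> carrier A \<Longrightarrow> \<psi> a \<in> \<psi> ` P \<longleftrightarrow> a \<in> P"
  using psi_inj by blast

text \<open>Homogeneous test elements \<open>x\<close>, \<open>y\<close> have homogeneous preimages
  \<open>a\<close>, \<open>b\<close>. The image under \<open>\<psi>\<close> of a product
  \<open>a \<otimes> r \<otimes> b\<close> is a nonzero multiple of a test product of
  \<open>x\<close> and \<open>y\<close>, so primeness of \<open>P\<close> can be applied to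
  \<open>a\<close> and \<open>b\<close>.\<close>

lemma image_prime_ideal:
  assumes P: "prime_ideal P A" and hom: "homogeneous P"
  shows "prime_ideal (\<psi> ` P) A"
proof (rule prime_ideal_homogI)
  have id: "ideal P A" using P by (simp add: prime_ideal_def)
  then interpret P: ideal P A .
  have Pc: "P \<subseteq> carrier A" using P.Icarr by auto
  show I: "ideal (\<psi> ` P) A" by (rule image_ideal[OF id hom])
  show "homogeneous (\<psi> ` P)" by (rule image_homogeneous[OF Pc hom])
  show "\<psi> ` P \<noteq> carrier A"
  proof
    assume "\<psi> ` P = carrier A"
    then have "a \<in> P" if "a \<in> carrier A" for a
      using mem_image_iff[OF Pc that] that by auto
    then show False using P Pc by (auto simp: prime_ideal_def)
  qed
  fix s t x y assume x: "x \<in> \<Gamma> s" and y: "y \<in> \<Gamma> t"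
    and xy: "\<And>u r. r \<in> \<Gamma> u \<Longrightarrow> x \<otimes> r \<otimes> y \<in> \<psi> ` P"
  obtain a where a: "a \<in> \<Gamma> (inv_into UNIV \<sigma> s)" "\<psi> a = x" using homog_preimage[OF x] by blast
  obtain b where b: "b \<in> \<Gamma> (inv_into UNIV \<sigma> t)" "\<psi> b = y" using homog_preimage[OF y] by blast
  have "a \<in> P \<or> b \<in> P"
  proof (rule prime_ideal_homogD[OF P])
    fix u r assume r: "r \<in> \<Gamma> u"
    have ar: "a \<otimes> r \<in> \<Gamma> (inv_into UNIV \<sigma> s + u)" using a r comp_mult by blast
    \<comment> \<open>One factor for each multiplication: \<open>a\<close> with \<open>r\<close>,
      and then \<open>a \<otimes> r\<close>, whose degree is the sum, with \<open>b\<close>.\<close>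
    have "x \<otimes> \<psi> r \<otimes> y = (c (inv_into UNIV \<sigma> s) u * c (inv_into UNIV \<sigma> s + u) (inv_into UNIV \<sigma> t)) \<odot> \<psi> (a \<otimes> r \<otimes> b)"
    proof -
      have "x \<otimes> \<psi> r = c (inv_into UNIV \<sigma> s) u \<odot> \<psi> (a \<otimes> r)" using psi_mult[OF a(1) r] a(2) by simp
      then have "x \<otimes> \<psi> r \<otimes> y = c (inv_into UNIV \<sigma> s) u \<odot> (\<psi> (a \<otimes> r) \<otimes> \<psi> b)"
        using ar b by (auto simp: smult_mult_left)
      also have "\<psi> (a \<otimes> r) \<otimes> \<psi> b = c (inv_into UNIV \<sigma> s + u) (inv_into UNIV \<sigma> t) \<odot> \<psi> (a \<otimes> r \<otimes> b)"
        using psi_mult[OF ar b(1)] .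
      finally show ?thesis using ar b comp_carrier by (simp add: smult_smult)
    qed
    moreover have "x \<otimes> \<psi> r \<otimes> y \<in> \<psi> ` P" using xy[OF psi_comp[OF r]] .
    ultimately have "inverse (c (inv_into UNIV \<sigma> s) u * c (inv_into UNIV \<sigma> s + u) (inv_into UNIV \<sigma> t)) \<odot>
        ((c (inv_into UNIV \<sigma> s) u * c (inv_into UNIV \<sigma> s + u) (inv_into UNIV \<sigma> t)) \<odot> \<psi> (a \<otimes> r \<otimes> b)) \<in> \<psi> ` P"
      using submodule_smult[OF ideal_submodule[OF I]] by simp
    then have "\<psi> (a \<otimes> r \<otimes> b) \<in> \<psi> ` P"
      using ar b nonzero comp_carrier by (subst (asm) smult_cancel) auto
    then show "a \<otimes> r \<otimes> b \<in> P" using ar b mem_image_iff[OF Pc] comp_carrier by simp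
  qed (use a b in auto)
  then show "x \<in> \<psi> ` P \<or> y \<in> \<psi> ` P" using a b by auto
qed

text \<open>Such maps are closed under inversion, with \<open>c\<close> inverted and evaluated at
  the preimage degrees. The reverse inclusion between the sets of primes is then the forward one for
  the inverse map.\<close>

lemma inverse:
  "twisted_automorphism A \<Gamma> (inv_into (carrier A) \<psi>) (inv_into UNIV \<sigma>)
     (\<lambda>s t. inverse (c (inv_into UNIV \<sigma> s) (inv_into UNIV \<sigma> t)))"
proof -
  let ?\<phi> = "inv_into (carrier A) \<psi>"
  have \<phi>: "?\<phi> (\<psi> a) = a" if "a \<in> carrier A" for a
    using psi_bij that by (simp add: bij_betw_def inv_into_f_f)
  have \<psi>: "\<exists>b\<in>carrier A. a = \<psi> b" if "a \<in> carrier A" for a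
    using psi_bij that by (auto simp: bij_betw_def)
  show ?thesis
  proof unfold_locales
    show "bij_betw ?\<phi> (carrier A) (carrier A)" by (rule bij_betw_inv_into[OF psi_bij])
    show "?\<phi> (a \<oplus> b) = ?\<phi> a \<oplus> ?\<phi> b" if "a \<in> carrier A" "b \<in> carrier A" for a b
      using \<psi>[OF that(1)] \<psi>[OF that(2)] by (auto simp: \<phi> simp flip: psi_add)
    show "?\<phi> (k \<odot> a) = k \<odot> ?\<phi> a" if "a \<in> carrier A" for a k
      using \<psi>[OF that(1)] by (auto simp: \<phi> simp flip: psi_smult)
    show "?\<phi> a \<in> \<Gamma> (inv_into UNIV \<sigma> s)" if a: "a \<in> \<Gamma> s" for a s
    proof -
      from homog_preimage[OF a] obtain b where "b \<in> \<Gamma> (inv_into UNIV \<sigma> s)" "\<psi> b = a" by blast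
      then show ?thesis using \<phi>[of b] by auto
    qed
    show "bij (inv_into UNIV \<sigma>)" using bij_degree by (rule bij_imp_bij_inv)
    show "inverse (c (inv_into UNIV \<sigma> s) (inv_into UNIV \<sigma> t)) \<noteq> 0" for s t using nonzero by simp
    show "?\<phi> a \<otimes> ?\<phi> b = inverse (c (inv_into UNIV \<sigma> s) (inv_into UNIV \<sigma> t)) \<odot> ?\<phi> (a \<otimes> b)"
      if a: "a \<in> \<Gamma> s" and b: "b \<in> \<Gamma> t" for a b s t
    proof -
      obtain x where x: "x \<in> \<Gamma> (inv_into UNIV \<sigma> s)" "\<psi> x = a" using homog_preimage[OF a] by blast
      obtain y where y: "y \<in> \<Gamma> (inv_into UNIV \<sigma> t)" "\<psi> y = b" using homog_preimage[OF b] by blast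
      have xy: "x \<in> carrier A" "y \<in> carrier A" using x y by auto
      have "a \<otimes> b = \<psi> (c (inv_into UNIV \<sigma> s) (inv_into UNIV \<sigma> t) \<odot> (x \<otimes> y))"
        using psi_mult[OF x(1) y(1)] x y xy by (simp add: psi_smult)
      then have "?\<phi> (a \<otimes> b) = c (inv_into UNIV \<sigma> s) (inv_into UNIV \<sigma> t) \<odot> (x \<otimes> y)"
        using xy by (simp add: \<phi>)
      then show ?thesis using xy x(2) y(2) nonzero \<phi> smult_cancel by auto
    qed
  qed
qed

lemma image_homogeneous_primes:
  "{\<psi> ` P | P. prime_ideal P A \<and> homogeneous P} = {P. prime_ideal P A \<and> homogeneous P}"
proof -
  interpret inv: twisted_automorphism A \<Gamma> "inv_into (carrier A) \<psi>" "inv_into UNIV \<sigma>"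
    "\<lambda>s t. inverse (c (inv_into UNIV \<sigma> s) (inv_into UNIV \<sigma> t))" by (rule inverse)
  have prime_sub: "P \<subseteq> carrier A" if "prime_ideal P A" for P
  proof -
    interpret ideal P A using that by (simp add: prime_ideal_def)
    show ?thesis using Icarr by auto
  qed
  have "\<exists>P. Q = \<psi> ` P \<and> prime_ideal P A \<and> homogeneous P"
    if Q: "prime_ideal Q A" "homogeneous Q" for Q
  proof (intro exI conjI)
    show "prime_ideal (inv_into (carrier A) \<psi> ` Q) A" "homogeneous (inv_into (carrier A) \<psi> ` Q)"
      using inv.image_prime_ideal[OF Q] inv.image_homogeneous[OF prime_sub[OF Q(1)] Q(2)] by auto
    show "Q = \<psi> ` (inv_into (carrier A) \<psi> ` Q)"
      using prime_sub[OF Q(1)] psi_bij by (simp add: bij_betw_def image_inv_into_cancel)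
  qed
  then show ?thesis
    using image_prime_ideal image_homogeneous prime_sub by blast
qed

end

section \<open>Quotients of graded algebras\<close>

lemma (in kalgebra)
  assumes I: "ideal I A"
  shows quot_carrier: "carrier (alg_quot A I) = (\<lambda>a. I +> a) ` carrier A"
    and quot_mult: "\<And>a b. a \<in> carrier A \<Longrightarrow> b \<in> carrier A \<Longrightarrow>
      (I +> a) \<otimes>\<^bsub>alg_quot A I\<^esub> (I +> b) = I +> (a \<otimes> b)"
    and quot_add: "\<And>a b. a \<in> carrier A \<Longrightarrow> b \<in> carrier A \<Longrightarrow>
      (I +> a) \<oplus>\<^bsub>alg_quot A I\<^esub> (I +> b) = I +> (a \<oplus> b)"
    and quot_one: "\<one>\<^bsub>alg_quot A I\<^esub> = I +> \<one>"
    and quot_zero: "\<zero>\<^bsub>alg_quot A I\<^esub> = I +> \<zero>"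
    and quot_smult: "\<And>a c. a \<in> carrier A \<Longrightarrow> c \<odot>\<^bsub>alg_quot A I\<^esub> (I +> a) = I +> (c \<odot> a)"
    and quot_eq_zero: "\<And>a. a \<in> carrier A \<Longrightarrow> I +> a = \<zero>\<^bsub>alg_quot A I\<^esub> \<longleftrightarrow> a \<in> I"
proof -
  interpret I: ideal I A by fact
  interpret Q: ring_hom_ring A "A Quot I" "(+>) I" by (rule I.rcos_ring_hom_ring)
  show "carrier (alg_quot A I) = (\<lambda>a. I +> a) ` carrier A"
    unfolding alg_quot_def FactRing_def A_RCOSETS_def' by auto
  show "(I +> a) \<otimes>\<^bsub>alg_quot A I\<^esub> (I +> b) = I +> (a \<otimes> b)"
    "(I +> a) \<oplus>\<^bsub>alg_quot A I\<^esub> (I +> b) = I +> (a \<oplus> b)"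
    if "a \<in> carrier A" "b \<in> carrier A" for a b
    using that by (simp_all add: alg_quot_def)
  show "\<one>\<^bsub>alg_quot A I\<^esub> = I +> \<one>" "\<zero>\<^bsub>alg_quot A I\<^esub> = I +> \<zero>"
    using Q.hom_one Q.hom_zero by (simp_all add: alg_quot_def)
  have zero: "\<zero>\<^bsub>alg_quot A I\<^esub> = I"
    unfolding alg_quot_def FactRing_def by simp
  show "I +> a = \<zero>\<^bsub>alg_quot A I\<^esub> \<longleftrightarrow> a \<in> I" if "a \<in> carrier A" for a
    using that I.a_rcos_const I.rcos_const_imp_mem unfolding zero by blast
  show "c \<odot>\<^bsub>alg_quot A I\<^esub> (I +> a) = I +> (c \<odot> a)" if a: "a \<in> carrier A" for a c
  proof -
    \<comment> \<open>Scalars act on a coset by a union over its representatives. All members of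
      this union coincide, because \<open>I\<close> is stable under scalars.\<close>
    have "I +> (c \<odot> x) = I +> (c \<odot> a)" if "x \<in> I +> a" for x
    proof -
      from that obtain i where i: "i \<in> I" "x = i \<oplus> a"
        by (auto simp: a_r_coset_def')
      have "c \<odot> i \<in> I" using submodule_smult[OF ideal_submodule[OF I] i(1)] .
      moreover have "c \<odot> x = c \<odot> i \<oplus> c \<odot> a" using a i I.Icarr by (simp add: smult_add)
      ultimately have "c \<odot> x \<in> I +> (c \<odot> a)" by (auto simp: a_r_coset_def')
      then show ?thesis using a by (intro I.a_repr_independence'[symmetric]) auto
    qed
    moreover have "a \<in> I +> a" using a I.a_rcos_self by blast
    ultimately have "(\<Union>x\<in>I +> a. I +> (c \<odot> x)) = I +> (c \<odot> a)" by blast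
    then show ?thesis by (simp add: alg_quot_def)
  qed
qed

lemma (in kalgebra) quot_kalgebra:
  assumes I: "ideal I A"
  shows "kalgebra (alg_quot A I)"
proof -
  note [simp] = quot_carrier[OF I] quot_mult[OF I] quot_add[OF I] quot_one[OF I] quot_zero[OF I]
    quot_smult[OF I]
  have inv: "(I +> (\<ominus> a)) \<oplus>\<^bsub>alg_quot A I\<^esub> (I +> a) = \<zero>\<^bsub>alg_quot A I\<^esub>" if "a \<in> carrier A" for a
    using that by (simp add: l_neg)
  show ?thesis
  proof (intro kalgebra.intro kalgebra_axioms.intro ringI abelian_groupI monoidI)
    fix x assume "x \<in> carrier (alg_quot A I)"
    then obtain a where "a \<in> carrier A" "x = I +> a" by auto
    then show "\<exists>y\<in>carrier (alg_quot A I). y \<oplus>\<^bsub>alg_quot A I\<^esub> x = \<zero>\<^bsub>alg_quot A I\<^esub>"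
      using inv[of a] by (intro bexI[of _ "I +> (\<ominus> a)"]) auto
  qed (auto simp: a_ac m_assoc l_distr r_distr smult_add_left smult_add smult_smult
      smult_mult_left smult_mult_right)
qed

context graded_algebra
begin

text \<open>The elements whose components all lie in the generated ideal form an ideal
  \<open>K\<close> containing \<open>R\<close>, so minimality places the generated ideal inside
  \<open>K\<close>.\<close>

lemma homogeneous_genideal:
  assumes R: "R \<subseteq> carrier A" and hom: "\<And>r. r \<in> R \<Longrightarrow> \<exists>s. r \<in> \<Gamma> s"
  shows "homogeneous (genideal A R)"
proof -
  let ?I = "genideal A R"
  interpret I: ideal ?I A by (rule genideal_ideal[OF R])
  have sub: "submodule ?I scalars A" by (rule ideal_submodule) (rule I.is_ideal)
  define K where "K = {a \<in> carrier A. \<forall>s. parts a s \<in> ?I}"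
  have "ideal K A"
  proof (rule idealI_submodule)
    show "submodule K scalars A"
      using sub by (auto simp: submodule_iff K_def parts_add parts_smult)
    fix x a assume xa: "x \<in> carrier A" "a \<in> K"
    then have a: "a \<in> carrier A" "\<And>s. parts a s \<in> ?I" by (auto simp: K_def)
    have "parts x s \<otimes> parts a t \<in> ?I" "parts a t \<otimes> parts x s \<in> ?I" for s t
      using a(2) xa(1) I.I_l_closed I.I_r_closed by auto
    then have "parts (x \<otimes> a) u \<in> ?I" "parts (a \<otimes> x) u \<in> ?I" for u
      using xa(1) a(1) by (auto simp: parts_mult intro!: submodule_finsum[OF sub])
    then show "x \<otimes> a \<in> K" "a \<otimes> x \<in> K" using xa a by (auto simp: K_def)
  qed
  moreover have "R \<subseteq> K"
  proof
    fix r assume r: "r \<in> R"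
    then obtain s where "r \<in> \<Gamma> s" using hom by blast
    moreover have "r \<in> ?I" using genideal_self[OF R] r by blast
    ultimately show "r \<in> K" using I.zero_closed by (auto simp: K_def parts_homog)
  qed
  ultimately have "?I \<subseteq> K" by (rule genideal_minimal)
  then show ?thesis by (auto simp: homogeneous_def K_def)
qed

context
  fixes I
  assumes I: "ideal I A" and hom: "homogeneous I"
begin

definition quot_comp :: "'d \<Rightarrow> 'a set set" where
  "quot_comp s = (\<lambda>a. I +> a) ` \<Gamma> s"

interpretation Q: kalgebra "alg_quot A I"
  by (rule quot_kalgebra[OF I])

lemma quot_comp_submodule: "submodule (quot_comp s) scalars (alg_quot A I)"
  unfolding Q.submodule_iff
proof (intro conjI ballI allI)
  show "quot_comp s \<subseteq> carrier (alg_quot A I)"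
    by (auto simp: quot_carrier[OF I] quot_comp_def)
  show "\<zero>\<^bsub>alg_quot A I\<^esub> \<in> quot_comp s"
    by (auto simp: quot_zero[OF I] quot_comp_def)
  fix x assume "x \<in> quot_comp s"
  then obtain a where a: "a \<in> \<Gamma> s" "x = I +> a" by (auto simp: quot_comp_def)
  then show "c \<odot>\<^bsub>alg_quot A I\<^esub> x \<in> quot_comp s" for c
    by (auto simp: quot_smult[OF I] quot_comp_def)
  fix y assume "y \<in> quot_comp s"
  then obtain b where b: "b \<in> \<Gamma> s" "y = I +> b" by (auto simp: quot_comp_def)
  then show "x \<oplus>\<^bsub>alg_quot A I\<^esub> y \<in> quot_comp s"
    using a by (auto simp: quot_add[OF I] quot_comp_def)
qed

lemma quot_comp_one: "\<one>\<^bsub>alg_quot A I\<^esub> \<in> quot_comp 0"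
  using comp_one by (auto simp: quot_one[OF I] quot_comp_def)

lemma quot_comp_mult:
  "x \<in> quot_comp s \<Longrightarrow> y \<in> quot_comp t \<Longrightarrow> x \<otimes>\<^bsub>alg_quot A I\<^esub> y \<in> quot_comp (s + t)"
  using comp_mult by (auto simp: quot_comp_def quot_mult[OF I])

text \<open>Lift the family to homogeneous \<open>g s\<close>. The sum of the lifts lies in
  \<open>I\<close>, and homogeneity of \<open>I\<close> puts each summand into
  \<open>I\<close>.\<close>

lemma quot_comp_indep:
  assumes T: "finite T" and f: "\<forall>s. f s \<in> quot_comp s"
    and sum: "finsum (alg_quot A I) f T = \<zero>\<^bsub>alg_quot A I\<^esub>" and s: "s \<in> T"
  shows "f s = \<zero>\<^bsub>alg_quot A I\<^esub>"
proof -
  have "\<forall>s. \<exists>a. a \<in> \<Gamma> s \<and> f s = I +> a" using f by (auto simp: quot_comp_def)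
  then obtain g where g: "\<And>s. g s \<in> \<Gamma> s" "\<And>s. f s = I +> g s" by metis
  have sum_g: "finsum (alg_quot A I) f T = I +> finsum A g T"
    using T
  proof (induction T rule: finite_induct)
    case empty
    show ?case by (simp add: quot_zero[OF I])
  next
    case (insert t T)
    have "f u \<in> carrier (alg_quot A I)" for u
      using g by (auto simp: quot_carrier[OF I])
    then have "finsum (alg_quot A I) f (insert t T) = f t \<oplus>\<^bsub>alg_quot A I\<^esub> finsum (alg_quot A I) f T"
      using insert by (intro Q.finsum_insert) auto
    moreover have "finsum A g (insert t T) = g t \<oplus> finsum A g T"
      using insert g(1) by (intro finsum_insert) auto
    moreover have "g t \<in> carrier A" "finsum A g T \<in> carrier A"
      using g(1) by (auto intro!: finsum_closed)
    ultimately show ?case using insert.IH g(2)[of t] by (simp add: quot_add[OF I])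
  qed
  have gc: "g \<in> T \<rightarrow> carrier A" using g(1) by auto
  have "finsum A g T \<in> I"
    using sum quot_eq_zero[OF I finsum_closed[OF gc]] by (simp add: sum_g)
  then have "parts (finsum A g T) s \<in> I" using hom by (simp add: homogeneous_def)
  moreover have "parts (finsum A g T) s = g s"
  proof -
    have "parts (finsum A g T) s = finsum A (\<lambda>t. if s = t then g t else \<zero>) T"
      using gc by (simp add: parts_finsum[OF T] parts_homog[OF g(1)])
    then show ?thesis using add.finprod_singleton[OF s T gc] by simp
  qed
  ultimately show ?thesis
    using quot_eq_zero[OF I, of "g s"] g by auto
qed

end

end


section \<open>Algebras generated by homogeneous elements\<close>

lemma (in ring) foldr_mult_append:
  assumes "set xs \<subseteq> carrier R" "set ys \<subseteq> carrier R"
  shows "foldr (\<otimes>) (xs @ ys) \<one> = foldr (\<otimes>) xs \<one> \<otimes> foldr (\<otimes>) ys \<one>"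
proof -
  have closed: "set zs \<subseteq> carrier R \<Longrightarrow> foldr (\<otimes>) zs \<one> \<in> carrier R" for zs
    by (induction zs) auto
  show ?thesis using assms by (induction xs) (auto simp: closed m_assoc)
qed

text \<open>The shape of \<open>qgrass_grading\<close> with minors and contents replaced by
  arbitrary generators \<open>g\<close> of degrees \<open>d\<close>, so that the general arguments
  do not mention quantum matrices.\<close>

definition gen_comp ::
  "('k::field, 'a) module \<Rightarrow> ('i \<Rightarrow> 'a) \<Rightarrow> ('i \<Rightarrow> 'd::monoid_add) \<Rightarrow> 'i set \<Rightarrow> 'd \<Rightarrow> 'a set" where
  "gen_comp A g d Ix s = lin_span A
     {foldr (\<otimes>\<^bsub>A\<^esub>) (map g is) \<one>\<^bsub>A\<^esub> | is. set is \<subseteq> Ix \<and> sum_list (map d is) = s}"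

locale generated_graded_algebra = graded_algebra A "gen_comp A g d Ix"
  for A :: "('k::field, 'a) module" (structure)
    and g :: "'i \<Rightarrow> 'a" and d :: "'i \<Rightarrow> 'd::linordered_ab_group_add" and Ix :: "'i set" +
  assumes gens_carrier: "g ` Ix \<subseteq> carrier A"
begin

abbreviation comps :: "'d \<Rightarrow> 'a set" where
  "comps \<equiv> gen_comp A g d Ix"

lemma gen_mem: "i \<in> Ix \<Longrightarrow> g i \<in> comps (d i)"
  unfolding gen_comp_def using gens_carrier
  by (intro subsetD[OF lin_span_superset] CollectI exI[of _ "[i]"]) auto

lemma monomial_mem:
  "set is \<subseteq> Ix \<Longrightarrow> foldr (\<otimes>) (map g is) \<one> \<in> comps (sum_list (map d is))"
  using comp_one comp_mult[OF gen_mem] by (induction "is") auto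

lemma comps_subset:
  assumes "submodule V scalars A"
    and "\<And>is. set is \<subseteq> Ix \<Longrightarrow> sum_list (map d is) = s \<Longrightarrow> foldr (\<otimes>) (map g is) \<one> \<in> V"
  shows "comps s \<subseteq> V"
  unfolding gen_comp_def using assms by (intro lin_span_least) auto

text \<open>A degree attained by no word in the generators has the span of the empty set as its
  component, and that span is zero.\<close>

lemma comps_degree:
  assumes "a \<in> comps s" "a \<noteq> \<zero>"
  shows "\<exists>is. set is \<subseteq> Ix \<and> s = sum_list (map d is)"
proof (rule ccontr)
  assume "\<not> ?thesis"
  then have "comps s \<subseteq> {\<zero>}"
    by (intro comps_subset) (auto simp: submodule_iff)
  then show False using assms by auto
qed

text \<open>On a monomial, split off the first generator: \<open>mult\<close> recovers the image of
  the product from the product of the images after division by the nonzero \<open>c\<close>.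
  Linearity extends this to spans.\<close>

lemma twisted_hom_comp:
  fixes \<psi> :: "'a \<Rightarrow> 'a" and \<sigma> :: "'d \<Rightarrow> 'd"
  assumes closed: "\<And>a. a \<in> carrier A \<Longrightarrow> \<psi> a \<in> carrier A"
    and add: "\<And>a b. a \<in> carrier A \<Longrightarrow> b \<in> carrier A \<Longrightarrow> \<psi> (a \<oplus> b) = \<psi> a \<oplus> \<psi> b"
    and smult: "\<And>a k. a \<in> carrier A \<Longrightarrow> \<psi> (k \<odot> a) = k \<odot> \<psi> a"
    and one: "\<psi> \<one> = \<one>"
    and nonzero: "\<And>s t. c s t \<noteq> 0"
    and mult: "\<And>a b s t. a \<in> comps s \<Longrightarrow> b \<in> comps t \<Longrightarrow> \<psi> a \<otimes> \<psi> b = c s t \<odot> \<psi> (a \<otimes> b)"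
    and \<sigma>: "\<sigma> 0 = 0" "\<And>s t. \<sigma> (s + t) = \<sigma> s + \<sigma> t"
    and gen: "\<And>i. i \<in> Ix \<Longrightarrow> \<psi> (g i) \<in> comps (\<sigma> (d i))"
    and a: "a \<in> comps s"
  shows "\<psi> a \<in> comps (\<sigma> s)"
proof -
  have "\<psi> (foldr (\<otimes>) (map g is) \<one>) \<in> comps (\<sigma> (sum_list (map d is)))" if "set is \<subseteq> Ix" for "is"
    using that
  proof (induction "is")
    case Nil
    then show ?case using one comp_one \<sigma> by simp
  next
    case (Cons i "is")
    let ?b = "foldr (\<otimes>) (map g is) \<one>"
    have i: "g i \<in> comps (d i)" and b: "?b \<in> comps (sum_list (map d is))"
      using Cons.prems gen_mem monomial_mem by auto
    have "\<psi> (g i) \<otimes> \<psi> ?b \<in> comps (\<sigma> (d i) + \<sigma> (sum_list (map d is)))"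
      using Cons gen by (intro comp_mult) auto
    then have "inverse (c (d i) (sum_list (map d is))) \<odot> (\<psi> (g i) \<otimes> \<psi> ?b)
        \<in> comps (\<sigma> (d i + sum_list (map d is)))"
      using \<sigma> by auto
    moreover have "\<psi> (g i \<otimes> ?b) \<in> carrier A" using i b by (intro closed) auto
    ultimately show ?case
      using mult[OF i b] nonzero smult_cancel by simp
  qed
  moreover have "submodule {a \<in> carrier A. \<psi> a \<in> comps (\<sigma> s)} scalars A"
  proof -
    have "\<psi> \<zero> = \<zero>" using smult[of \<zero> 0] closed by simp
    then show ?thesis by (auto simp: submodule_iff add smult)
  qed
  ultimately have "comps s \<subseteq> {a \<in> carrier A. \<psi> a \<in> comps (\<sigma> s)}"
    using monomial_mem comp_carrier by (intro comps_subset) blast+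
  then show ?thesis using a by auto
qed

text \<open>Provides the uniqueness of the torus action. Both maps agree on monomials in the
  generators, hence on each component, hence on sums of components.\<close>

lemma hom_eq_rescale:
  fixes \<phi> :: "'a \<Rightarrow> 'a"
  assumes \<phi>: "\<phi> \<in> alg_iso A A"
    and \<chi>: "\<chi> 0 = 1" "\<And>s t. \<chi> (s + t) = \<chi> s * \<chi> t"
    and gen: "\<And>i. i \<in> Ix \<Longrightarrow> \<phi> (g i) = \<chi> (d i) \<odot> g i"
    and a: "a \<in> carrier A"
  shows "\<phi> a = rescale \<chi> a"
proof -
  have hom: "\<And>a. a \<in> carrier A \<Longrightarrow> \<phi> a \<in> carrier A"
    "\<And>a b. a \<in> carrier A \<Longrightarrow> b \<in> carrier A \<Longrightarrow> \<phi> (a \<oplus> b) = \<phi> a \<oplus> \<phi> b"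
    "\<And>a b. a \<in> carrier A \<Longrightarrow> b \<in> carrier A \<Longrightarrow> \<phi> (a \<otimes> b) = \<phi> a \<otimes> \<phi> b"
    "\<phi> \<one> = \<one>"
    "\<And>a c. a \<in> carrier A \<Longrightarrow> \<phi> (c \<odot> a) = c \<odot> \<phi> a"
    using \<phi> by (auto simp: alg_iso_def ring_iso_def ring_hom_def)
  have zero: "\<phi> \<zero> = \<zero>" using hom(5)[of \<zero> 0] hom(1) by simp
  have mon: "\<phi> (foldr (\<otimes>) (map g is) \<one>) = \<chi> (sum_list (map d is)) \<odot> foldr (\<otimes>) (map g is) \<one>"
    if "set is \<subseteq> Ix" for "is"
    using that
  proof (induction "is")
    case Nil
    then show ?case using hom(4) \<chi> by simp
  next
    case (Cons i "is")
    let ?b = "foldr (\<otimes>) (map g is) \<one>"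
    have "g i \<in> carrier A" "?b \<in> carrier A"
      using Cons.prems gens_carrier comp_carrier[OF monomial_mem, of "is"] by auto
    then show ?case
      using Cons gen \<chi> by (simp add: hom(3) smult_mult_left smult_mult_right smult_smult mult.commute)
  qed
  have on_comp: "\<phi> b = \<chi> s \<odot> b" if b: "b \<in> comps s" for b s
  proof -
    have "submodule {a \<in> carrier A. \<phi> a = \<chi> s \<odot> a} scalars A"
      by (auto simp: submodule_iff zero hom smult_add smult_smult mult.commute)
    then have "comps s \<subseteq> {a \<in> carrier A. \<phi> a = \<chi> s \<odot> a}"
      using mon comp_carrier[OF monomial_mem] by (intro comps_subset) auto
    then show ?thesis using b by auto
  qed
  show ?thesis
    using a
  proof (induction a rule: homog_induct)
    case zero
    then show ?case using \<open>\<phi> \<zero> = \<zero>\<close> rescale_homog[OF comp_zero] by simp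
  next
    case (homog s)
    show ?case using on_comp[OF parts_comp[OF a]] rescale_homog[OF parts_comp[OF a]] by simp
  next
    case (add x y)
    then show ?case by (simp add: hom rescale_add)
  qed
qed

end

text \<open>Independence is inherited from the ambient spaces \<open>D s\<close>, which contain the
  spans of monomials. Decompositions exist because the finite sums of homogeneous elements form a
  subalgebra containing the generators, hence all of \<open>alg_generate\<close>.\<close>

lemma (in kalgebra) generated_graded_algebra:
  fixes D :: "'d::linordered_ab_group_add \<Rightarrow> 'a set"
  assumes D_sub: "\<And>s. submodule (D s) scalars A"
    and D_one: "\<one> \<in> D 0"
    and D_mult: "\<And>s t a b. a \<in> D s \<Longrightarrow> b \<in> D t \<Longrightarrow> a \<otimes> b \<in> D (s + t)"
    and D_indep: "\<And>T f s. finite T \<Longrightarrow> \<forall>s. f s \<in> D s \<Longrightarrow> finsum A f T = \<zero> \<Longrightarrow> s \<in> T \<Longrightarrow> f s = \<zero>"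
    and gens: "\<And>i. i \<in> Ix \<Longrightarrow> g i \<in> D (d i)"
  shows "generated_graded_algebra (A\<lparr>carrier := alg_generate A (g ` Ix)\<rparr>) g d Ix"
proof -
  define C where "C = alg_generate A (g ` Ix)"
  define B where "B = A\<lparr>carrier := C\<rparr>"
  have Dc: "D s \<subseteq> carrier A" for s using D_sub by (auto simp: submodule_iff)
  have gc: "g ` Ix \<subseteq> carrier A" using gens Dc by blast
  have C_ring: "subring C A" and C_sub: "submodule C scalars A" and gC: "g ` Ix \<subseteq> C"
    unfolding C_def
    using alg_generate_subring[OF gc] alg_generate_submodule[OF gc] alg_generate_superset by auto
  have Cc: "C \<subseteq> carrier A" using C_sub by (simp add: submodule_iff)
  interpret B: kalgebra B unfolding B_def by (rule kalgebra_subalgebra[OF C_ring C_sub])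
  have [simp]: "carrier B = C" "(\<otimes>\<^bsub>B\<^esub>) = (\<otimes>)" "(\<oplus>\<^bsub>B\<^esub>) = (\<oplus>)" "\<one>\<^bsub>B\<^esub> = \<one>" "\<zero>\<^bsub>B\<^esub> = \<zero>"
    "(\<odot>\<^bsub>B\<^esub>) = (\<odot>)"
    by (simp_all add: B_def)
  define M where "M s = {foldr (\<otimes>) (map g is) \<one> | is. set is \<subseteq> Ix \<and> sum_list (map d is) = s}" for s
  have \<Gamma>: "gen_comp B g d Ix s = lin_span B (M s)" for s
    by (simp add: gen_comp_def M_def)
  have M_C: "M s \<subseteq> C" for s
  proof -
    have "foldr (\<otimes>) (map g is) \<one> \<in> C" if "set is \<subseteq> Ix" for "is"
      using that gC subringE[OF C_ring] by (induction "is") auto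
    then show ?thesis by (auto simp: M_def)
  qed
  have \<Gamma>_sub: "submodule (gen_comp B g d Ix s) scalars B" for s
    unfolding \<Gamma> using M_C by (intro B.lin_span_submodule) auto
  have M_\<Gamma>: "M s \<subseteq> gen_comp B g d Ix s" for s
    unfolding \<Gamma> by (rule B.lin_span_superset)
  have least: "gen_comp B g d Ix s \<subseteq> V" if "submodule V scalars B" "M s \<subseteq> V" for V s
    unfolding \<Gamma> using that by (rule B.lin_span_least)
  have \<Gamma>_C: "gen_comp B g d Ix s \<subseteq> C" for s
    using \<Gamma>_sub[of s] by (simp add: B.submodule_iff)
  have \<Gamma>_D: "gen_comp B g d Ix s \<subseteq> D s" for s
  proof -
    have "foldr (\<otimes>) (map g is) \<one> \<in> D (sum_list (map d is))" if "set is \<subseteq> Ix" for "is"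
      using that D_one D_mult gens by (induction "is") auto
    then have "M s \<subseteq> D s \<inter> C" using M_C by (auto simp: M_def)
    moreover have "submodule (D s \<inter> C) scalars B"
      using D_sub[of s] C_sub by (auto simp: B.submodule_iff submodule_iff)
    ultimately show ?thesis using least by blast
  qed
  have M_mult: "x \<otimes> y \<in> M (s + t)" if xy: "x \<in> M s" "y \<in> M t" for x y s t
  proof -
    obtain ks js where x: "x = foldr (\<otimes>) (map g ks) \<one>" "set ks \<subseteq> Ix" "sum_list (map d ks) = s"
      and y: "y = foldr (\<otimes>) (map g js) \<one>" "set js \<subseteq> Ix" "sum_list (map d js) = t"
      using xy by (auto simp: M_def)
    have "set (map g ks) \<subseteq> carrier A" "set (map g js) \<subseteq> carrier A"
      using x y gc by auto
    from foldr_mult_append[OF this] have "x \<otimes> y = foldr (\<otimes>) (map g (ks @ js)) \<one>"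
      using x y by simp
    then show ?thesis using x y unfolding M_def by (intro CollectI exI[of _ "ks @ js"]) auto
  qed
  have \<Gamma>_mult: "x \<otimes> y \<in> gen_comp B g d Ix (s + t)"
    if x: "x \<in> gen_comp B g d Ix s" and y: "y \<in> gen_comp B g d Ix t" for x y s t
  proof -
    note V = \<Gamma>_sub[of "s + t", unfolded B.submodule_iff, simplified]
    \<comment> \<open>Multiplicativity passes from monomials to spans one factor at a time: with one
      factor fixed, the admissible other factors form a subspace.\<close>
    have 1: "gen_comp B g d Ix s \<subseteq> {x \<in> C. x \<otimes> b \<in> gen_comp B g d Ix (s + t)}" if b: "b \<in> M t" for b
    proof (rule least)
      have bC: "b \<in> C" using b M_C by blast
      then show "submodule {x \<in> C. x \<otimes> b \<in> gen_comp B g d Ix (s + t)} scalars B"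
        using V C_sub Cc
        by (auto simp: B.submodule_iff submodule_iff l_distr smult_mult_left subset_iff)
      show "M s \<subseteq> {x \<in> C. x \<otimes> b \<in> gen_comp B g d Ix (s + t)}"
        using M_mult[OF _ b] M_C M_\<Gamma> by blast
    qed
    have "gen_comp B g d Ix t \<subseteq> {b \<in> C. x \<otimes> b \<in> gen_comp B g d Ix (s + t)}"
    proof (rule least)
      have xC: "x \<in> C" using x \<Gamma>_C by blast
      then show "submodule {b \<in> C. x \<otimes> b \<in> gen_comp B g d Ix (s + t)} scalars B"
        using V C_sub Cc
        by (auto simp: B.submodule_iff submodule_iff r_distr smult_mult_right subset_iff)
      show "M t \<subseteq> {b \<in> C. x \<otimes> b \<in> gen_comp B g d Ix (s + t)}"
        using 1 x M_C by blast
    qed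
    then show ?thesis using y by blast
  qed
  \<comment> \<open>\<open>finsum\<close> refers to the carrier, so agreement of the sums in
    \<open>B\<close> and \<open>A\<close> is not definitional; \<open>D_indep\<close> speaks about
    sums in \<open>A\<close>.\<close>
  have finsum_B: "finsum B f T = finsum A f T" if "finite T" "\<forall>s. f s \<in> C" for f T
    using that(1)
  proof (induction T rule: finite_induct)
    case (insert x T)
    have "finsum B f (insert x T) = f x \<oplus> finsum B f T"
      using insert that(2) B.finsum_insert[of T x f] by auto
    moreover have "finsum A f (insert x T) = f x \<oplus> finsum A f T"
      using insert that(2) Cc by (intro finsum_insert) auto
    ultimately show ?case using insert by simp
  qed (use B.finsum_empty in simp)
  have one_\<Gamma>: "\<one> \<in> gen_comp B g d Ix 0"
    by (rule subsetD[OF M_\<Gamma>]) (auto simp: M_def intro: exI[of _ "[]"])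
  define S where "S = {a. \<exists>f T. finite T \<and> (\<forall>s. f s \<in> gen_comp B g d Ix s) \<and>
    (\<forall>s. s \<notin> T \<longrightarrow> f s = \<zero>) \<and> a = finsum B f T}"
  have SI: "finsum B f T \<in> S" if "finite T" "\<And>s. f s \<in> gen_comp B g d Ix s"
    "\<And>s. s \<notin> T \<Longrightarrow> f s = \<zero>" for f T
    using that unfolding S_def by blast
  have \<Gamma>_zero: "\<zero> \<in> gen_comp B g d Ix s" for s using \<Gamma>_sub[of s] by (simp add: B.submodule_iff)
  have \<Gamma>_S: "a \<in> S" if a: "a \<in> gen_comp B g d Ix s" for a s
  proof -
    have "finsum B (\<lambda>t. if t = s then a else \<zero>) {s} \<in> S"
      by (rule SI) (use a \<Gamma>_zero in auto)
    moreover have "a \<in> C" "a \<in> carrier A" using a \<Gamma>_C Cc by blast+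
    ultimately show ?thesis by simp
  qed
  have S_C: "S \<subseteq> C"
  proof
    fix a assume "a \<in> S"
    then obtain f T where "\<forall>s. f s \<in> gen_comp B g d Ix s" "a = finsum B f T"
      unfolding S_def by blast
    then show "a \<in> C" using B.finsum_closed[of f T] \<Gamma>_C by auto
  qed
  have S_add: "a \<oplus> b \<in> S" if "a \<in> S" "b \<in> S" for a b
  proof -
    from that obtain f1 T1 f2 T2 where 1: "finite T1" "\<And>s. f1 s \<in> gen_comp B g d Ix s"
        "\<And>s. s \<notin> T1 \<Longrightarrow> f1 s = \<zero>" "a = finsum B f1 T1"
      and 2: "finite T2" "\<And>s. f2 s \<in> gen_comp B g d Ix s"
        "\<And>s. s \<notin> T2 \<Longrightarrow> f2 s = \<zero>" "b = finsum B f2 T2"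
      unfolding S_def by blast
    have C: "f1 s \<in> C" "f2 s \<in> C" for s using 1(2) 2(2) \<Gamma>_C by auto
    have "a = finsum B f1 (T1 \<union> T2)" unfolding 1(4)
      using 1 2 C by (intro B.add.finprod_mono_neutral_cong_left) auto
    moreover have "b = finsum B f2 (T1 \<union> T2)" unfolding 2(4)
      using 1 2 C by (intro B.add.finprod_mono_neutral_cong_left) auto
    ultimately have "a \<oplus> b = finsum B (\<lambda>s. f1 s \<oplus> f2 s) (T1 \<union> T2)"
      using C B.finsum_addf[of f1 "T1 \<union> T2" f2] by auto
    moreover have "finsum B (\<lambda>s. f1 s \<oplus> f2 s) (T1 \<union> T2) \<in> S"
    proof (rule SI)
      show "f1 s \<oplus> f2 s \<in> gen_comp B g d Ix s" for s
        using 1(2) 2(2) \<Gamma>_sub[of s] by (auto simp: B.submodule_iff)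
    qed (use 1 2 in auto)
    ultimately show ?thesis by simp
  qed
  have S_smult: "c \<odot> a \<in> S" if "a \<in> S" for a c
  proof -
    from that obtain f T where 1: "finite T" "\<And>s. f s \<in> gen_comp B g d Ix s"
        "\<And>s. s \<notin> T \<Longrightarrow> f s = \<zero>" "a = finsum B f T"
      unfolding S_def by blast
    have C: "f s \<in> C" for s using 1(2) \<Gamma>_C by auto
    have "c \<odot> a = finsum B (\<lambda>s. c \<odot> f s) T"
      using B.finsum_smult[OF 1(1), of f c] C 1(4) by auto
    moreover have "finsum B (\<lambda>s. c \<odot> f s) T \<in> S"
      by (rule SI) (use 1 \<Gamma>_sub B.submodule_smult in auto)
    ultimately show ?thesis by simp
  qed
  have S_sub: "submodule S scalars B"
    using S_C S_add S_smult \<Gamma>_S[OF \<Gamma>_zero] by (auto simp: B.submodule_iff)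
  have S_mult: "a \<otimes> b \<in> S" if ab: "a \<in> S" "b \<in> S" for a b
  proof -
    from ab obtain f1 T1 f2 T2 where 1: "finite T1" "\<And>s. f1 s \<in> gen_comp B g d Ix s"
        "a = finsum B f1 T1"
      and 2: "finite T2" "\<And>s. f2 s \<in> gen_comp B g d Ix s" "b = finsum B f2 T2"
      unfolding S_def by blast
    have C: "f1 s \<in> C" "f2 s \<in> C" for s using 1(2) 2(2) \<Gamma>_C by auto
    have bC: "b \<in> C" using ab S_C by blast
    have "a \<otimes> b = finsum B (\<lambda>s. f1 s \<otimes> b) T1"
      using B.finsum_ldistr[OF 1(1), of b f1] C bC 1(3) by auto
    moreover have "f1 s \<otimes> b = finsum B (\<lambda>t. f1 s \<otimes> f2 t) T2" for s
      using B.finsum_rdistr[OF 2(1), of "f1 s" f2] C 2(3) by auto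
    moreover have "f1 s \<otimes> f2 t \<in> S" for s t using \<Gamma>_S[OF \<Gamma>_mult[OF 1(2) 2(2)]] .
    then have "finsum B (\<lambda>s. finsum B (\<lambda>t. f1 s \<otimes> f2 t) T2) T1 \<in> S"
      by (intro B.submodule_finsum[OF S_sub])
    ultimately show ?thesis by simp
  qed
  have "C \<subseteq> S"
    unfolding C_def
  proof (rule alg_generate_least)
    show sub: "submodule S scalars A"
      using S_sub S_C Cc by (auto simp: submodule_iff B.submodule_iff)
    show "subring S A"
    proof (rule subringI)
      show "\<ominus> a \<in> S" if "a \<in> S" for a
        using smult_minus_one[of a] submodule_smult[OF sub that, of "-1"] that S_C Cc by auto
    qed (use S_C Cc S_add S_mult \<Gamma>_S[OF one_\<Gamma>] in auto)
    have "g i \<in> M (d i)" if "i \<in> Ix" for i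
      using that gc unfolding M_def by (intro CollectI exI[of _ "[i]"]) auto
    then show "g ` Ix \<subseteq> S" using M_\<Gamma> \<Gamma>_S by blast
  qed
  have "generated_graded_algebra B g d Ix"
  proof (intro generated_graded_algebra.intro graded_algebra.intro graded_algebra_axioms.intro
      generated_graded_algebra_axioms.intro)
    show "kalgebra B" by (rule B.kalgebra_axioms)
    show "submodule (gen_comp B g d Ix s) scalars B" for s by (rule \<Gamma>_sub)
    show "\<one>\<^bsub>B\<^esub> \<in> gen_comp B g d Ix 0" using one_\<Gamma> by simp
    show "a \<otimes>\<^bsub>B\<^esub> b \<in> gen_comp B g d Ix (s + t)"
      if "a \<in> gen_comp B g d Ix s" "b \<in> gen_comp B g d Ix t" for a b s t
      using \<Gamma>_mult[OF that] by simp
    show "\<exists>f T. finite T \<and> (\<forall>s. f s \<in> gen_comp B g d Ix s) \<and> (\<forall>s. s \<notin> T \<longrightarrow> f s = \<zero>\<^bsub>B\<^esub>) \<and>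
        a = finsum B f T" if "a \<in> carrier B" for a
      using that \<open>C \<subseteq> S\<close> by (auto simp: S_def)
    show "f s = \<zero>\<^bsub>B\<^esub>" if "finite T" "\<forall>s. f s \<in> gen_comp B g d Ix s" "finsum B f T = \<zero>\<^bsub>B\<^esub>" "s \<in> T"
      for f T s
    proof -
      have "\<forall>s. f s \<in> C" "\<forall>s. f s \<in> D s" using that(2) \<Gamma>_C \<Gamma>_D by blast+
      then show ?thesis using D_indep[OF that(1), of f s] that finsum_B[OF that(1), of f] by auto
    qed
    show "g ` Ix \<subseteq> carrier B" using gC by simp
  qed
  then show ?thesis by (simp add: B_def C_def)
qed


section \<open>Isomorphisms from a twist\<close>

text \<open>The double sum collapses to the single term at \<open>(s, t)\<close>. A zero factor has
  empty support, and then both sides vanish.\<close>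

lemma (in graded_algebra) twist_mult_homog:
  assumes a: "a \<in> \<Gamma> s" and b: "b \<in> \<Gamma> t"
  shows "Tw a \<otimes>\<^bsub>twist c A \<Gamma>\<^esub> Tw b = Tw (c s t \<odot> (a \<otimes> b))"
proof -
  have ac: "a \<in> carrier A" and bc: "b \<in> carrier A" using a b by auto
  have supp: "{u. (if u = s then a else \<zero>) \<noteq> \<zero>} = (if a = \<zero> then {} else {s})"
    "{u. (if u = t then b else \<zero>) \<noteq> \<zero>} = (if b = \<zero> then {} else {t})" by auto
  show ?thesis
    using ac bc by (auto simp: twist_def Let_def parts_homog[OF a] parts_homog[OF b] supp)
qed

text \<open>Leaves the record \<open>twist\<close> behind. \<open>alg_iso\<close> consists of a
  bijection and equations on carriers, which transfer to the composite with \<open>Tw\<close>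
  without any ring structure on the twist.\<close>

lemma (in generated_graded_algebra) twisted_automorphism_of_twist_iso:
  fixes \<sigma> :: "'d \<Rightarrow> 'd"
  assumes \<theta>: "\<theta> \<in> alg_iso (twist c A comps) A" and nonzero: "\<And>s t. c s t \<noteq> 0"
    and \<sigma>: "bij \<sigma>" "\<sigma> 0 = 0" "\<And>s t. \<sigma> (s + t) = \<sigma> s + \<sigma> t"
    and gen: "\<And>i. i \<in> Ix \<Longrightarrow> \<theta> (Tw (g i)) \<in> comps (\<sigma> (d i))"
  shows "twisted_automorphism A comps (\<lambda>a. \<theta> (Tw a)) \<sigma> c"
proof -
  let ?\<psi> = "\<lambda>a. \<theta> (Tw a)"
  have hom: "\<theta> \<in> ring_hom (twist c A comps) A"
    and bij: "bij_betw \<theta> (Tw ` carrier A) (carrier A)"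
    and lin: "\<And>k a. a \<in> carrier A \<Longrightarrow> \<theta> (k \<odot>\<^bsub>twist c A comps\<^esub> Tw a) = k \<odot> ?\<psi> a"
    using \<theta> by (auto simp: alg_iso_def ring_iso_def twist_def)
  have bij\<psi>: "bij_betw ?\<psi> (carrier A) (carrier A)"
    using bij_betw_trans[of Tw "carrier A", OF _ bij] by (simp add: comp_def bij_betw_def inj_on_def)
  then have closed: "?\<psi> a \<in> carrier A" if "a \<in> carrier A" for a
    using that by (auto simp: bij_betw_def)
  have carr: "Tw a \<in> carrier (twist c A comps)" if "a \<in> carrier A" for a
    using that by (simp add: twist_def)
  have add: "?\<psi> (a \<oplus> b) = ?\<psi> a \<oplus> ?\<psi> b" if "a \<in> carrier A" "b \<in> carrier A" for a b
    using ring_hom_add[OF hom carr[OF that(1)] carr[OF that(2)]] by (simp add: twist_def)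
  have smult: "?\<psi> (k \<odot> a) = k \<odot> ?\<psi> a" if "a \<in> carrier A" for k a
    using lin[OF that] by (simp add: twist_def)
  have one: "?\<psi> \<one> = \<one>" using ring_hom_one[OF hom] by (simp add: twist_def)
  have mult: "?\<psi> a \<otimes> ?\<psi> b = c s t \<odot> ?\<psi> (a \<otimes> b)" if "a \<in> comps s" "b \<in> comps t" for a b s t
  proof -
    have ab: "a \<in> carrier A" "b \<in> carrier A" using that by auto
    have "?\<psi> a \<otimes> ?\<psi> b = ?\<psi> (c s t \<odot> (a \<otimes> b))"
      using ring_hom_mult[OF hom carr[OF ab(1)] carr[OF ab(2)]] twist_mult_homog[OF that] by simp
    then show ?thesis using ab smult by simp
  qed
  show ?thesis
  proof unfold_locales
    show "?\<psi> a \<in> comps (\<sigma> s)" if "a \<in> comps s" for a s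
      using twisted_hom_comp[of ?\<psi> c \<sigma>, OF closed add smult one nonzero mult \<sigma>(2,3) gen that] by simp
  qed (use bij\<psi> add smult \<sigma> nonzero mult in auto)
qed

section \<open>Free algebras\<close>

lemma free_alg_sel [simp]:
  "(\<otimes>\<^bsub>free_alg S\<^esub>) = (*)" "(\<oplus>\<^bsub>free_alg S\<^esub>) = (+)" "\<one>\<^bsub>free_alg S\<^esub> = 1"
  "\<zero>\<^bsub>free_alg S\<^esub> = 0" "(\<odot>\<^bsub>free_alg S\<^esub>) = (\<lambda>c f. fconst c * f)"
  by (simp_all add: free_alg_def)

lemma mem_free_alg:
  "f \<in> carrier (free_alg S) \<longleftrightarrow> (\<forall>w\<in>Poly_Mapping.keys f. set (letters w) \<subseteq> S)"
  by (simp add: free_alg_def)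

lemma letters_plus [simp]: "letters (v + w) = letters v @ letters w"
  by (simp add: plus_word_def)

lemma letters_zero [simp]: "letters 0 = []"
  by (simp add: zero_word_def)

lemma poly_mapping_sum_keys:
  "f = (\<Sum>w\<in>Poly_Mapping.keys f. Poly_Mapping.single w (Poly_Mapping.lookup f w))"
  by (rule poly_mapping_eqI)
    (auto simp: lookup_sum lookup_single when_def in_keys_iff if_distrib[of "\<lambda>f. f _"] cong: if_cong)

text \<open>Centrality is checked on single words: the empty word is neutral for concatenation, and
  coefficients commute.\<close>

lemma fconst_central: "fconst c * f = f * fconst c"
proof -
  have "fconst c * f = (\<Sum>w\<in>Poly_Mapping.keys f. fconst c * Poly_Mapping.single w (Poly_Mapping.lookup f w))"
    by (subst poly_mapping_sum_keys[of f]) (rule sum_distrib_left)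
  also have "\<dots> = (\<Sum>w\<in>Poly_Mapping.keys f. Poly_Mapping.single w (Poly_Mapping.lookup f w) * fconst c)"
    by (simp add: fconst_def mult_single mult.commute)
  also have "\<dots> = f * fconst c"
    using arg_cong[OF poly_mapping_sum_keys[of f], of "\<lambda>g. g * fconst c"]
    by (simp add: sum_distrib_right)
  finally show ?thesis .
qed

lemma fconst_add: "fconst (c + d) = fconst c + fconst d"
  by (simp add: fconst_def single_add)

lemma fconst_mult: "fconst (c * d) = fconst c * fconst d"
  by (simp add: fconst_def mult_single)

lemma fconst_one: "fconst 1 = 1"
  by (simp add: fconst_def)

lemma keys_fconst_mult: "Poly_Mapping.keys (fconst c * f) \<subseteq> Poly_Mapping.keys f"
  using keys_mult[of "fconst c" f] by (auto simp: fconst_def split: if_splits)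

lemma free_alg_kalgebra: "kalgebra (free_alg S :: ('k::field, 'x word \<Rightarrow>\<^sub>0 'k) module)"
proof -
  let ?C = "carrier (free_alg S :: ('k, 'x word \<Rightarrow>\<^sub>0 'k) module)"
  have add: "f + g \<in> ?C" if "f \<in> ?C" "g \<in> ?C" for f g :: "'x word \<Rightarrow>\<^sub>0 'k"
    using that keys_add[of f g] unfolding mem_free_alg by blast
  have mult: "f * g \<in> ?C" if "f \<in> ?C" "g \<in> ?C" for f g :: "'x word \<Rightarrow>\<^sub>0 'k"
    using that keys_mult[of f g] unfolding mem_free_alg by fastforce
  have smult: "fconst c * f \<in> ?C" if "f \<in> ?C" for c and f :: "'x word \<Rightarrow>\<^sub>0 'k"
    using that keys_fconst_mult[of c f] unfolding mem_free_alg by blast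
  have zero: "(0 :: 'x word \<Rightarrow>\<^sub>0 'k) \<in> ?C" and one: "(1 :: 'x word \<Rightarrow>\<^sub>0 'k) \<in> ?C"
    by (auto simp: mem_free_alg)
  have neg: "- f \<in> ?C" if "f \<in> ?C" for f :: "'x word \<Rightarrow>\<^sub>0 'k"
    using that by (simp add: mem_free_alg in_keys_iff)
  have left: "f * (fconst c * g) = fconst c * (f * g)" for c and f g :: "'x word \<Rightarrow>\<^sub>0 'k"
    by (metis fconst_central mult.assoc)
  have inv: "\<exists>g\<in>?C. g + f = 0" if "f \<in> ?C" for f :: "'x word \<Rightarrow>\<^sub>0 'k"
    using neg[OF that] by (intro bexI[of _ "- f"]) auto
  have inv2: "\<exists>g\<in>?C. f + g = 0" if "f \<in> ?C" for f :: "'x word \<Rightarrow>\<^sub>0 'k"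
    using inv[OF that] by (simp add: add.commute)
  show ?thesis
  proof (intro kalgebra.intro kalgebra_axioms.intro ringI abelian_groupI monoidI)
    fix c and f g :: "'x word \<Rightarrow>\<^sub>0 'k"
    show "f \<otimes>\<^bsub>free_alg S\<^esub> (c \<odot>\<^bsub>free_alg S\<^esub> g) = c \<odot>\<^bsub>free_alg S\<^esub> (f \<otimes>\<^bsub>free_alg S\<^esub> g)"
      by (simp add: left)
  qed (simp_all add: add mult smult zero one inv inv2 algebra_simps fconst_add fconst_mult fconst_one)
qed

definition word_degree :: "('x \<Rightarrow> 'd::monoid_add) \<Rightarrow> 'x word \<Rightarrow> 'd" where
  "word_degree \<delta> w = sum_list (map \<delta> (letters w))"

definition free_comp :: "'x set \<Rightarrow> ('x \<Rightarrow> 'd::monoid_add) \<Rightarrow> 'd \<Rightarrow> ('x word \<Rightarrow>\<^sub>0 'k::field) set" where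
  "free_comp S \<delta> s = {f \<in> carrier (free_alg S). \<forall>w\<in>Poly_Mapping.keys f. word_degree \<delta> w = s}"

lemma word_degree_plus: "word_degree \<delta> (v + w) = word_degree \<delta> v + word_degree \<delta> w"
  by (simp add: word_degree_def)

text \<open>Every word has one degree. Grouping the terms of \<open>f\<close> by degree therefore
  decomposes it, and elements of components of different degrees share no word.\<close>

lemma free_alg_graded:
  fixes \<delta> :: "'x \<Rightarrow> 'd::linordered_ab_group_add"
  shows "graded_algebra (free_alg S :: ('k::field, 'x word \<Rightarrow>\<^sub>0 'k) module) (free_comp S \<delta>)"
proof -
  let ?F = "free_alg S :: ('k, 'x word \<Rightarrow>\<^sub>0 'k) module"
  interpret F: kalgebra ?F by (rule free_alg_kalgebra)
  have finsum: "finsum ?F f T = sum f T" if "finite T" "f \<in> T \<rightarrow> carrier ?F" for f T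
    using that
  proof (induction T rule: finite_induct)
    case empty
    show ?case using F.finsum_empty[of f] by simp
  next
    case (insert t T)
    then show ?case using F.finsum_insert[of T t f] by (simp add: Pi_def)
  qed
  show ?thesis
  proof (intro graded_algebra.intro graded_algebra_axioms.intro)
    show "kalgebra ?F" by (rule F.kalgebra_axioms)
  next
    fix s
    show "submodule (free_comp S \<delta> s) scalars ?F"
      unfolding F.submodule_iff
    proof (intro conjI ballI allI)
      fix f g :: "'x word \<Rightarrow>\<^sub>0 'k" assume fg: "f \<in> free_comp S \<delta> s" "g \<in> free_comp S \<delta> s"
      then show "f \<oplus>\<^bsub>?F\<^esub> g \<in> free_comp S \<delta> s"
        using keys_add[of f g] F.a_closed[of f g] unfolding free_comp_def by auto
    next
      fix c and f :: "'x word \<Rightarrow>\<^sub>0 'k" assume fg: "f \<in> free_comp S \<delta> s"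
      then show "c \<odot>\<^bsub>?F\<^esub> f \<in> free_comp S \<delta> s"
        using keys_fconst_mult[of c f] F.smult_closed[of f c] unfolding free_comp_def by auto
    next
      show "\<zero>\<^bsub>?F\<^esub> \<in> free_comp S \<delta> s" using F.zero_closed by (simp add: free_comp_def)
    qed (auto simp: free_comp_def)
  next
    show "\<one>\<^bsub>?F\<^esub> \<in> free_comp S \<delta> 0"
      using F.one_closed by (simp add: free_comp_def word_degree_def)
  next
    fix f g :: "'x word \<Rightarrow>\<^sub>0 'k" and s t
    assume "f \<in> free_comp S \<delta> s" "g \<in> free_comp S \<delta> t"
    then show "f \<otimes>\<^bsub>?F\<^esub> g \<in> free_comp S \<delta> (s + t)"
      using keys_mult[of f g] F.m_closed[of f g]
      by (fastforce simp: free_comp_def word_degree_plus)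
  next
    fix f assume f: "f \<in> carrier ?F"
    define h where "h s = (\<Sum>w | w \<in> Poly_Mapping.keys f \<and> word_degree \<delta> w = s.
      Poly_Mapping.single w (Poly_Mapping.lookup f w))" for s
    let ?T = "word_degree \<delta> ` Poly_Mapping.keys f"
    have h: "h s \<in> free_comp S \<delta> s" for s
    proof -
      have "Poly_Mapping.keys (h s) \<subseteq> {w \<in> Poly_Mapping.keys f. word_degree \<delta> w = s}"
        by (auto simp: h_def in_keys_iff lookup_sum lookup_single when_def if_distrib[of "\<lambda>f. f _"]
            elim!: sum.not_neutral_contains_not_neutral split: if_splits)
      then show ?thesis using f by (auto simp: free_comp_def mem_free_alg)
    qed
    have f_eq: "f = sum h ?T"
      unfolding h_def
      using trans[OF poly_mapping_sum_keys[of f] sum.image_gen[OF finite_keys,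
            where h = "\<lambda>w. Poly_Mapping.single w (Poly_Mapping.lookup f w)" and g = "word_degree \<delta>"]] .
    have "h s \<in> carrier ?F" for s
      using h[of s] by (simp add: free_comp_def)
    then have "finsum ?F h ?T = sum h ?T"
      by (intro finsum) auto
    then have "f = finsum ?F h ?T" by (rule trans[OF f_eq sym])
    moreover have "h s = 0" if "s \<notin> ?T" for s
      unfolding h_def using that by (intro sum.neutral) auto
    ultimately show "\<exists>h T. finite T \<and> (\<forall>s. h s \<in> free_comp S \<delta> s) \<and>
        (\<forall>s. s \<notin> T \<longrightarrow> h s = \<zero>\<^bsub>?F\<^esub>) \<and> f = finsum ?F h T"
      using h by (intro exI[of _ h] exI[of _ ?T] conjI allI impI) (simp_all del: image_iff)
  next
    fix T f s
    assume T: "finite T" and f: "\<forall>s. f s \<in> free_comp S \<delta> s"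
      and 0: "finsum ?F f T = \<zero>\<^bsub>?F\<^esub>" and s: "s \<in> T"
    have "sum f T = 0" using 0 finsum[OF T, of f] f by (auto simp: free_comp_def)
    moreover have "Poly_Mapping.lookup (sum f T) w = Poly_Mapping.lookup (f s) w"
      if "w \<in> Poly_Mapping.keys (f s)" for w
    proof -
      have "Poly_Mapping.lookup (f t) w = 0" if "t \<noteq> s" for t
      proof (rule ccontr)
        assume "\<not> ?thesis"
        then have "w \<in> Poly_Mapping.keys (f t)" by (simp add: in_keys_iff)
        then have "word_degree \<delta> w = t" using f unfolding free_comp_def by blast
        moreover have "word_degree \<delta> w = s"
          using f \<open>w \<in> Poly_Mapping.keys (f s)\<close> unfolding free_comp_def by blast
        ultimately show False using that by simp
      qed
      then show ?thesis
        unfolding lookup_sum using T s by (subst sum.remove[of T s]) auto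
    qed
    ultimately have "w \<notin> Poly_Mapping.keys (f s)" for w
      by (metis in_keys_iff lookup_zero)
    then have "Poly_Mapping.keys (f s) = {}" by blast
    then show "f s = \<zero>\<^bsub>?F\<^esub>" by simp
  qed
qed


section \<open>The grading of the quantum grassmannian\<close>

abbreviation column_degree :: "nat \<times> nat \<Rightarrow> (nat \<Rightarrow>\<^sub>0 int)" where
  "column_degree x \<equiv> Poly_Mapping.single (snd x) 1"

lemma qgen_mem:
  "i \<in> {1..r} \<Longrightarrow> j \<in> {1..s} \<Longrightarrow>
    qgen i j \<in> free_comp (matrix_letters r s) column_degree (Poly_Mapping.single j 1)"
  by (simp add: qgen_def free_comp_def mem_free_alg word_degree_def)

text \<open>All terms of a relator are multiples of products of two generators with the same pair of
  columns, up to order.\<close>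

lemma qmatrix_relators_homogeneous:
  assumes "x \<in> qmatrix_relators q r s"
  shows "\<exists>u. x \<in> free_comp (matrix_letters r s) column_degree u"
proof -
  let ?F = "free_alg (matrix_letters r s) :: ('a, (nat \<times> nat) word \<Rightarrow>\<^sub>0 'a) module"
  let ?C = "free_comp (matrix_letters r s) column_degree :: _ \<Rightarrow> ((nat \<times> nat) word \<Rightarrow>\<^sub>0 'a) set"
  interpret F: graded_algebra ?F ?C by (rule free_alg_graded)
  have mult: "f * g \<in> ?C (u + v)" if "f \<in> ?C u" "g \<in> ?C v" for f g u v
    using F.comp_mult[OF that] by simp
  have smult: "fconst c * f \<in> ?C u" if "f \<in> ?C u" for c f u
    using F.comp_smult[OF that, of c] by simp
  have diff: "f - g \<in> ?C u" if "f \<in> ?C u" "g \<in> ?C u" for f g u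
  proof -
    have "fconst (- 1) = (- 1 :: (nat \<times> nat) word \<Rightarrow>\<^sub>0 'a)"
      by (simp add: fconst_def single_uminus flip: single_one)
    then show ?thesis
      using F.comp_add[OF that(1) smult[OF that(2), of "- 1"]] by simp
  qed
  have smult: "fconst c * f * g \<in> ?C u" if "f * g \<in> ?C u" for c f g u
    using smult[OF that] by (simp add: mult.assoc)
  have gen: "qgen i j * qgen k l \<in> ?C (Poly_Mapping.single j 1 + Poly_Mapping.single l 1)"
    "qgen k l * qgen i j \<in> ?C (Poly_Mapping.single j 1 + Poly_Mapping.single l 1)"
    if "i \<in> {1..r}" "j \<in> {1..s}" "k \<in> {1..r}" "l \<in> {1..s}" for i j k l
    using mult[OF qgen_mem[OF that(1,2)] qgen_mem[OF that(3,4)]]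
      mult[OF qgen_mem[OF that(3,4)] qgen_mem[OF that(1,2)]] by (simp_all add: add.commute)
  from assms consider
    (row) i j l where "i \<in> {1..r}" "j \<in> {1..s}" "l \<in> {1..s}"
      "x = qgen i j * qgen i l - fconst q * qgen i l * qgen i j"
  | (column) i j k where "i \<in> {1..r}" "k \<in> {1..r}" "j \<in> {1..s}"
      "x = qgen i j * qgen k j - fconst q * qgen k j * qgen i j"
  | (commute) i j k l where "i \<in> {1..r}" "k \<in> {1..r}" "j \<in> {1..s}" "l \<in> {1..s}"
      "x = qgen i j * qgen k l - qgen k l * qgen i j"
  | (cross) i j k l where "i \<in> {1..r}" "k \<in> {1..r}" "j \<in> {1..s}" "l \<in> {1..s}"
      "x = qgen i j * qgen k l - qgen k l * qgen i j - fconst (q - inverse q) * qgen i l * qgen k j"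
    unfolding qmatrix_relators_def by blast
  then show ?thesis
  proof cases
    case row
    then show ?thesis
      using diff[OF gen(1)[of i j i l] smult[OF gen(2)[of i j i l]]] by blast
  next
    case column
    then show ?thesis
      using diff[OF gen(1)[of i j k j] smult[OF gen(2)[of i j k j]]] by blast
  next
    case commute
    then show ?thesis
      using diff[OF gen(1)[of i j k l] gen(2)[of i j k l]] by blast
  next
    \<comment> \<open>Exchanging the rows in \<open>gen\<close> gives
      \<open>qgen i l * qgen k j\<close> the degree of the columns \<open>j\<close> and
      \<open>l\<close>, written in the same order as for the other two terms.\<close>
    case cross
    then show ?thesis
      using diff[OF diff[OF gen(1)[of i j k l] gen(2)[of i j k l]] smult[OF gen(2)[of k j i l]]] by blast
  qed
qed

lemma qmatrix_ideal:
  shows qmatrix_ideal_ideal: "ideal (qmatrix_ideal q r s) (free_alg (matrix_letters r s))"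
    and qmatrix_ideal_homogeneous: "graded_algebra.homogeneous (free_alg (matrix_letters r s))
      (free_comp (matrix_letters r s) column_degree) (qmatrix_ideal q r s)"
proof -
  interpret F: graded_algebra "free_alg (matrix_letters r s)" "free_comp (matrix_letters r s) column_degree"
    by (rule free_alg_graded)
  have relators: "qmatrix_relators q r s \<subseteq> carrier (free_alg (matrix_letters r s))"
    using qmatrix_relators_homogeneous F.comp_carrier by blast
  show "ideal (qmatrix_ideal q r s) (free_alg (matrix_letters r s))"
    unfolding qmatrix_ideal_def by (rule F.genideal_ideal[OF relators])
  show "F.homogeneous (qmatrix_ideal q r s)"
    unfolding qmatrix_ideal_def
    by (rule F.homogeneous_genideal[OF relators qmatrix_relators_homogeneous])
qed

lemma prod_list_free_comp:
  fixes \<delta> :: "'x \<Rightarrow> 'd::linordered_ab_group_add" and f :: "'i \<Rightarrow> ('x word \<Rightarrow>\<^sub>0 'k::field)"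
  assumes "\<And>i. i \<in> set xs \<Longrightarrow> f i \<in> free_comp S \<delta> (e i)"
  shows "prod_list (map f xs) \<in> free_comp S \<delta> (sum_list (map e xs))"
proof -
  interpret F: graded_algebra "free_alg S :: ('k, _) module" "free_comp S \<delta>" by (rule free_alg_graded)
  show ?thesis
    using assms
  proof (induction xs)
    case Nil
    show ?case using F.comp_one by simp
  next
    case (Cons x xs)
    then show ?case using F.comp_mult[of "f x" "e x" "prod_list (map f xs)"] by simp
  qed
qed

lemma sum_free_comp:
  fixes \<delta> :: "'x \<Rightarrow> 'd::linordered_ab_group_add" and f :: "'i \<Rightarrow> ('x word \<Rightarrow>\<^sub>0 'k::field)"
  assumes "\<And>i. i \<in> T \<Longrightarrow> f i \<in> free_comp S \<delta> s"
  shows "(\<Sum>i\<in>T. f i) \<in> free_comp S \<delta> s"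
proof -
  interpret F: graded_algebra "free_alg S :: ('k, _) module" "free_comp S \<delta>" by (rule free_alg_graded)
  show ?thesis
    using assms
  proof (induction T rule: infinite_finite_induct)
    case (insert x T)
    then show ?case using F.comp_add[of "f x" s "sum f T"] by simp
  qed (use F.comp_zero[of s] in simp_all)
qed

text \<open>A permutation moves the rows and leaves the columns in place, so each term of the minor
  uses every column of \<open>J\<close> exactly once.\<close>

lemma maxminor_degree:
  fixes q :: "'k::field"
  assumes J: "J \<in> index_sets m n"
  shows "\<exists>x\<in>free_comp (matrix_letters m n) column_degree (grass_content J).
    maxminor q m n J = qmatrix_ideal q m n +>\<^bsub>free_alg (matrix_letters m n)\<^esub> x"
proof -
  interpret F: graded_algebra "free_alg (matrix_letters m n) :: ('k, _) module"
    "free_comp (matrix_letters m n) column_degree" by (rule free_alg_graded)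
  define i j where "i k = sorted_list_of_set {1..m} ! k" and "j k = sorted_list_of_set J ! k" for k
  define x where "x = (\<Sum>\<sigma> | \<sigma> permutes {..<m}. fconst ((- q) ^ coxeter_length m \<sigma>) *
    prod_list (map (\<lambda>k. qgen (i (\<sigma> k)) (j k)) [0..<m]))"
  have J': "J \<subseteq> {1..n}" "card J = m" "finite J"
    using J finite_subset[of J "{1..n}"] by (auto simp: index_sets_def)
  have i: "i k \<in> {1..m}" if "k < m" for k
    using that nth_mem[of k "sorted_list_of_set {1..m}"] by (simp add: i_def)
  have j: "j k \<in> {1..n}" if "k < m" for k
    using that nth_mem[of k "sorted_list_of_set J"] J' by (auto simp: j_def)
  have "map j [0..<m] = sorted_list_of_set J"
    using J' map_nth[of "sorted_list_of_set J"] by (simp add: j_def[abs_def])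
  then have "sum_list (map (\<lambda>k. Poly_Mapping.single (j k) 1) [0..<m]) =
      sum_list (map (\<lambda>k. Poly_Mapping.single k (1::int)) (sorted_list_of_set J))"
    by (metis (no_types, lifting) map_map comp_apply map_eq_conv)
  also have "\<dots> = grass_content J"
    using J' by (simp add: grass_content_def sum_list_distinct_conv_sum_set)
  finally have content: "sum_list (map (\<lambda>k. Poly_Mapping.single (j k) 1) [0..<m]) = grass_content J" .
  have "x \<in> free_comp (matrix_letters m n) column_degree (grass_content J)"
    unfolding x_def
  proof (rule sum_free_comp)
    fix \<sigma> assume "\<sigma> \<in> {\<sigma>. \<sigma> permutes {..<m}}"
    then have "\<sigma> k < m" if "k < m" for k using that permutes_in_image[of \<sigma> "{..<m}" k] by simp
    then have "prod_list (map (\<lambda>k. qgen (i (\<sigma> k)) (j k)) [0..<m]) \<in>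
        free_comp (matrix_letters m n) column_degree (grass_content J)"
      unfolding content[symmetric] using i j by (intro prod_list_free_comp qgen_mem) auto
    from F.comp_smult[OF this] show "fconst ((- q) ^ coxeter_length m \<sigma>) *
        prod_list (map (\<lambda>k. qgen (i (\<sigma> k)) (j k)) [0..<m]) \<in>
        free_comp (matrix_letters m n) column_degree (grass_content J)" by simp
  qed
  moreover have "maxminor q m n J = qmatrix_ideal q m n +>\<^bsub>free_alg (matrix_letters m n)\<^esub> x"
    by (simp add: maxminor_def qminor_def Let_def x_def i_def j_def)
  ultimately show ?thesis by blast
qed

abbreviation qgrass_comp :: "'k::field \<Rightarrow> nat \<Rightarrow> nat \<Rightarrow> (nat \<Rightarrow>\<^sub>0 int) \<Rightarrow> 'k qmat set" where
  "qgrass_comp q m n \<equiv> gen_comp (qgrassmannian q m n) (maxminor q m n) grass_content (index_sets m n)"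

lemma qgrass_grading_eq: "qgrass_grading q m n = qgrass_comp q m n"
  by (rule ext) (simp add: qgrass_grading_def gen_comp_def)

text \<open>The ambient components are the images of the column grading of the free algebra in its
  quotient by the homogeneous ideal \<open>qmatrix_ideal\<close>.\<close>

lemma qgrassmannian_graded:
  "generated_graded_algebra (qgrassmannian q m n) (maxminor q m n) grass_content (index_sets m n)"
proof -
  interpret F: graded_algebra "free_alg (matrix_letters m n)"
    "free_comp (matrix_letters m n) column_degree" by (rule free_alg_graded)
  let ?I = "qmatrix_ideal q m n"
  note I = qmatrix_ideal_ideal[of q m n] and hom = qmatrix_ideal_homogeneous[of m n q]
  interpret Q: kalgebra "qmatrices q m n"
    unfolding qmatrices_def by (rule F.quot_kalgebra[OF I])
  show ?thesis
    unfolding qgrassmannian_def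
  proof (rule Q.generated_graded_algebra[where D = "F.quot_comp ?I"])
    show "submodule (F.quot_comp ?I s) scalars (qmatrices q m n)" for s
      unfolding qmatrices_def by (rule F.quot_comp_submodule[OF I hom])
    show "\<one>\<^bsub>qmatrices q m n\<^esub> \<in> F.quot_comp ?I 0"
      unfolding qmatrices_def by (rule F.quot_comp_one[OF I hom])
    show "a \<otimes>\<^bsub>qmatrices q m n\<^esub> b \<in> F.quot_comp ?I (s + t)"
      if "a \<in> F.quot_comp ?I s" "b \<in> F.quot_comp ?I t" for a b s t
      using that unfolding qmatrices_def by (rule F.quot_comp_mult[OF I hom])
    show "f s = \<zero>\<^bsub>qmatrices q m n\<^esub>"
      if "finite T" "\<forall>s. f s \<in> F.quot_comp ?I s" "finsum (qmatrices q m n) f T = \<zero>\<^bsub>qmatrices q m n\<^esub>"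
        "s \<in> T" for f T s
      using that unfolding qmatrices_def by (rule F.quot_comp_indep[OF I hom])
    show "maxminor q m n J \<in> F.quot_comp ?I (grass_content J)" if "J \<in> index_sets m n" for J
      unfolding F.quot_comp_def[OF I hom] using maxminor_degree[OF that, of q] by blast
  qed
qed

lemma lookup_grass_content:
  "finite J \<Longrightarrow> Poly_Mapping.lookup (grass_content J) j = (if j \<in> J then 1 else 0)"
  by (simp add: grass_content_def lookup_sum lookup_single when_def)

section \<open>The torus action\<close>

text \<open>The character of the degree group by which \<open>h\<close> acts. Degrees may be
  negative, hence the integer powers.\<close>

definition torus_char :: "nat \<Rightarrow> (nat \<Rightarrow> 'k::field) \<Rightarrow> (nat \<Rightarrow>\<^sub>0 int) \<Rightarrow> 'k" where
  "torus_char n h s = (\<Prod>j\<in>{1..n}. h j powi Poly_Mapping.lookup s j)"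

lemma torus_char_zero: "torus_char n h 0 = 1"
  by (simp add: torus_char_def)

lemma torus_char_nonzero: "h \<in> torus n \<Longrightarrow> torus_char n h s \<noteq> 0"
  by (auto simp: torus_char_def torus_def)

lemma torus_char_add: "h \<in> torus n \<Longrightarrow> torus_char n h (s + t) = torus_char n h s * torus_char n h t"
  by (auto simp: torus_char_def torus_def lookup_add power_int_add prod.distrib[symmetric] intro!: prod.cong)

lemma torus_char_content:
  assumes "J \<in> index_sets m n"
  shows "torus_char n h (grass_content J) = (\<Prod>j\<in>J. h j)"
proof -
  have J: "J \<subseteq> {1..n}" "finite J"
    using assms finite_subset[of J "{1..n}"] by (auto simp: index_sets_def)
  have "torus_char n h (grass_content J) = (\<Prod>j\<in>{1..n}. if j \<in> J then h j else 1)"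
    unfolding torus_char_def using J by (intro prod.cong) (auto simp: lookup_grass_content)
  also have "\<dots> = (\<Prod>j\<in>J. h j)"
    using J by (simp add: prod.inter_restrict[symmetric] Int_absorb1 flip: prod.inter_restrict)
  finally show ?thesis .
qed

text \<open>Shows that the \<open>THE\<close> in \<open>torus_act\<close> is justified: rescaling by
  a character exists as an automorphism, its values on the minors determine it on the carrier, and
  extensionality fixes it elsewhere.\<close>

lemma torus_act_eq:
  assumes h: "h \<in> torus n"
  shows "torus_act q m n h = restrict
    (graded_algebra.rescale (qgrassmannian q m n) (qgrass_comp q m n) (torus_char n h))
    (carrier (qgrassmannian q m n))"
proof -
  interpret G: generated_graded_algebra "qgrassmannian q m n" "maxminor q m n" grass_content "index_sets m n"
    by (rule qgrassmannian_graded)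
  let ?\<phi> = "restrict (G.rescale (torus_char n h)) (carrier (qgrassmannian q m n))"
  have iso: "G.rescale (torus_char n h) \<in> alg_iso (qgrassmannian q m n) (qgrassmannian q m n)"
    using h by (intro G.rescale_alg_iso torus_char_add torus_char_nonzero)
  show ?thesis
    unfolding torus_act_def
  proof (rule the_equality, intro conjI ballI)
    show "?\<phi> \<in> extensional (carrier (qgrassmannian q m n))" by simp
    show "?\<phi> \<in> alg_iso (qgrassmannian q m n) (qgrassmannian q m n)"
      using iso by (auto simp: alg_iso_def intro: G.ring_iso_restrict[of "G.rescale (torus_char n h)"])
    fix J assume J: "J \<in> index_sets m n"
    then have "maxminor q m n J \<in> carrier (qgrassmannian q m n)"
      using G.gens_carrier by blast
    then show "?\<phi> (maxminor q m n J) = prod h J \<odot>\<^bsub>qgrassmannian q m n\<^esub> maxminor q m n J"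
      using G.rescale_homog[OF G.gen_mem[OF J]] torus_char_content[OF J, of h] by simp
  next
    fix \<phi> :: "'a qmat \<Rightarrow> 'a qmat"
    assume \<phi>: "\<phi> \<in> extensional (carrier (qgrassmannian q m n)) \<and>
      \<phi> \<in> alg_iso (qgrassmannian q m n) (qgrassmannian q m n) \<and>
      (\<forall>J\<in>index_sets m n. \<phi> (maxminor q m n J) = prod h J \<odot>\<^bsub>qgrassmannian q m n\<^esub> maxminor q m n J)"
    show "\<phi> = ?\<phi>"
    proof (rule extensionalityI)
      show "\<phi> \<in> extensional (carrier (qgrassmannian q m n))" using \<phi> by simp
      show "?\<phi> \<in> extensional (carrier (qgrassmannian q m n))" by simp
      fix a assume a: "a \<in> carrier (qgrassmannian q m n)"
      have "\<phi> a = G.rescale (torus_char n h) a"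
        using \<phi> a
        by (intro G.hom_eq_rescale) (simp_all add: torus_char_zero torus_char_add[OF h] torus_char_content)
      then show "\<phi> a = ?\<phi> a" using a by simp
    qed
  qed
qed

section \<open>Torus-invariant primes as homogeneous primes\<close>

lemma power_int_inj_not_root_of_unity:
  fixes q :: "'k::field"
  assumes q: "q \<noteq> 0" and nr: "\<forall>k::nat. 0 < k \<longrightarrow> q ^ k \<noteq> 1" and eq: "q powi a = q powi b"
  shows "a = b"
proof -
  have le: "a \<le> b" if "q powi a = q powi b" for a b
  proof (rule ccontr)
    assume "\<not> a \<le> b"
    then have "q ^ nat (a - b) = q powi (a - b)" by (simp add: power_int_def)
    also have "\<dots> = 1" using that q by (simp add: power_int_diff)
    finally show False using nr \<open>\<not> a \<le> b\<close> by simp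
  qed
  show ?thesis using le[OF eq] le[OF eq[symmetric]] by simp
qed

lemma HSpec_eq:
  fixes q :: "'k::field"
  assumes q: "q \<noteq> 0" and nr: "\<forall>k::nat. 0 < k \<longrightarrow> q ^ k \<noteq> 1"
  shows "HSpec q m n = {P. prime_ideal P (qgrassmannian q m n) \<and>
    graded_algebra.homogeneous (qgrassmannian q m n) (qgrass_comp q m n) P}"
proof -
  interpret G: generated_graded_algebra "qgrassmannian q m n" "maxminor q m n" grass_content "index_sets m n"
    by (rule qgrassmannian_graded)
  have "(\<forall>h\<in>torus n. torus_act q m n h ` P = P) \<longleftrightarrow> G.homogeneous P"
    if "prime_ideal P (qgrassmannian q m n)" for P
  proof
    interpret P: ideal P "qgrassmannian q m n" using that by (simp add: prime_ideal_def)
    have sub: "submodule P scalars (qgrassmannian q m n)"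
      by (rule G.ideal_submodule) (rule P.is_ideal)
    have act: "torus_act q m n h ` P = G.rescale (torus_char n h) ` P" if "h \<in> torus n" for h
      using torus_act_eq[OF that, of q m] P.Icarr by (auto simp: image_iff)
    show "\<forall>h\<in>torus n. torus_act q m n h ` P = P" if "G.homogeneous P"
      using act G.rescale_homogeneous[OF sub that] torus_char_nonzero by metis
    assume inv: "\<forall>h\<in>torus n. torus_act q m n h ` P = P"
    show "G.homogeneous P"
    proof (rule G.homogeneous_rescale[OF sub, where H = "torus_char n ` torus n"])
      fix \<chi> :: "(nat \<Rightarrow>\<^sub>0 int) \<Rightarrow> 'k" assume "\<chi> \<in> torus_char n ` torus n"
      then show "G.rescale \<chi> ` P \<subseteq> P" using inv act by auto
    next
      fix s t a b
      assume a: "a \<in> G.comps s" "a \<noteq> \<zero>\<^bsub>qgrassmannian q m n\<^esub>"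
        and b: "b \<in> G.comps t" "b \<noteq> \<zero>\<^bsub>qgrassmannian q m n\<^esub>" and st: "s \<noteq> t"
      \<comment> \<open>The degree type admits indices outside \<open>{1..n}\<close>, which the
        torus does not see. A nonzero component excludes them, since its degree is a sum of
        contents.\<close>
      have supp: "Poly_Mapping.lookup u j = 0"
        if u: "c \<in> G.comps u" "c \<noteq> \<zero>\<^bsub>qgrassmannian q m n\<^esub>" and j: "j \<notin> {1..n}" for u c j
      proof -
        obtain Js where Js: "set Js \<subseteq> index_sets m n" "u = sum_list (map grass_content Js)"
          using G.comps_degree[OF u] by blast
        have "Poly_Mapping.lookup (sum_list (map grass_content Js)) j = 0"
          using Js(1)
        proof (induction Js)
          case (Cons J Js)
          then have "J \<subseteq> {1..n}" "finite J"
            using finite_subset[of J "{1..n}"] by (auto simp: index_sets_def)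
          then show ?case using Cons j by (auto simp: lookup_add lookup_grass_content)
        qed simp
        then show ?thesis using Js by simp
      qed
      obtain j where j: "Poly_Mapping.lookup s j \<noteq> Poly_Mapping.lookup t j"
        using st by (auto simp: poly_mapping_eq_iff fun_eq_iff)
      have jn: "j \<in> {1..n}" using j supp[OF a] supp[OF b] by metis
      \<comment> \<open>A torus element concentrated at an index where \<open>s\<close> and
        \<open>t\<close> differ: its characters at \<open>s\<close> and \<open>t\<close> are powers
        of \<open>q\<close> with different exponents.\<close>
      define h where "h i = (if i = j then q else 1)" for i
      have h: "h \<in> torus n" using q by (simp add: torus_def h_def)
      have "torus_char n h u = q powi Poly_Mapping.lookup u j" for u
      proof -
        have "torus_char n h u = (\<Prod>i\<in>{1..n}. if i = j then q powi Poly_Mapping.lookup u j else 1)"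
          unfolding torus_char_def by (intro prod.cong) (auto simp: h_def)
        then show ?thesis using jn by simp
      qed
      then have "torus_char n h s \<noteq> torus_char n h t"
        using j power_int_inj_not_root_of_unity[OF q nr] by metis
      then show "\<exists>\<chi>\<in>(torus_char n ` torus n :: ((nat \<Rightarrow>\<^sub>0 int) \<Rightarrow> 'k) set). \<chi> s \<noteq> \<chi> t"
        using h by blast
    qed
  qed
  then show ?thesis by (auto simp: HSpec_def)
qed

section \<open>The cyclic shift of degrees\<close>

text \<open>On \<open>{1..n}\<close> this is the cycle that \<open>\<theta>\<close> induces on
  columns. For positive \<open>n\<close> it fixes all other indices, because degrees live on all of
  \<open>nat\<close> and their shift has to be a bijection of the whole degree group.\<close>

definition cycle :: "nat \<Rightarrow> nat \<Rightarrow> nat" where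
  "cycle n j = (if j \<in> {1..<n} then Suc j else if j = n then 1 else j)"

text \<open>\<open>map_key\<close> precomposes with its argument, so moving the entry at
  \<open>j\<close> to \<open>cycle n j\<close> takes the inverse permutation.\<close>

definition rotate_degree :: "nat \<Rightarrow> (nat \<Rightarrow>\<^sub>0 int) \<Rightarrow> (nat \<Rightarrow>\<^sub>0 int)" where
  "rotate_degree n = Poly_Mapping.map_key (inv_into UNIV (cycle n))"

lemma bij_cycle: "0 < n \<Longrightarrow> bij (cycle n)"
  by (rule bij_betw_byWitness[where f' = "\<lambda>j. if j = 1 then n else if j \<in> {2..n} then j - 1 else j"])
    (auto simp: cycle_def)

lemma rotate_degree_add: "0 < n \<Longrightarrow> rotate_degree n (s + t) = rotate_degree n s + rotate_degree n t"
  by (simp add: rotate_degree_def map_key_plus bij_is_inj bij_imp_bij_inv bij_cycle)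

lemma rotate_degree_zero: "0 < n \<Longrightarrow> rotate_degree n 0 = 0"
  by (simp add: rotate_degree_def bij_is_inj bij_imp_bij_inv bij_cycle)

lemma rotate_degree_single:
  assumes "0 < n"
  shows "rotate_degree n (Poly_Mapping.single j v) = Poly_Mapping.single (cycle n j) v"
proof -
  have "inj (inv_into UNIV (cycle n))" "inv_into UNIV (cycle n) (cycle n j) = j"
    using bij_cycle[OF assms] by (simp_all add: bij_is_inj bij_imp_bij_inv)
  then show ?thesis
    using map_key_single[of "inv_into UNIV (cycle n)" "cycle n j" v] by (simp add: rotate_degree_def)
qed

lemma rotate_degree_content:
  assumes "0 < n" "finite J"
  shows "rotate_degree n (grass_content J) = grass_content (cycle n ` J)"
proof -
  have "rotate_degree n (grass_content J) = (\<Sum>j\<in>J. Poly_Mapping.single (cycle n j) 1)"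
    unfolding grass_content_def using assms(2)
    by (induction J rule: finite_induct)
      (simp_all add: rotate_degree_zero rotate_degree_add rotate_degree_single assms(1))
  also have "\<dots> = grass_content (cycle n ` J)"
    unfolding grass_content_def
    using bij_cycle[OF assms(1)] by (subst sum.reindex) (auto simp: bij_def inj_on_def)
  finally show ?thesis .
qed

lemma bij_rotate_degree:
  assumes "0 < n" shows "bij (rotate_degree n)"
proof (rule o_bij)
  note b = bij_cycle[OF assms]
  have i: "inj (cycle n)" "inj (inv_into UNIV (cycle n))"
    using b by (simp_all add: bij_is_inj bij_imp_bij_inv)
  have c: "inv_into UNIV (cycle n) \<circ> cycle n = (\<lambda>x. x)" "cycle n \<circ> inv_into UNIV (cycle n) = (\<lambda>x. x)"
    using b by (simp_all add: bij_is_inj fun_eq_iff bij_is_surj surj_f_inv_f)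
  show "Poly_Mapping.map_key (cycle n) \<circ> rotate_degree n = id"
    using map_key_compose[OF i] by (auto simp: fun_eq_iff rotate_degree_def c map_key_id)
  show "rotate_degree n \<circ> Poly_Mapping.map_key (cycle n) = id"
    using map_key_compose[OF i(2,1)] by (auto simp: fun_eq_iff rotate_degree_def c map_key_id)
qed

theorem corollary6p2:
  fixes q p :: "'k::field" and m n :: nat
    and \<theta> :: "'k qmat twisted \<Rightarrow> 'k qmat"
  assumes "0 < m" and "m < n"
    and "q \<noteq> 0" and "p ^ m = q ^ 2"
    and not_root_of_unity: "\<forall>k::nat. 0 < k \<longrightarrow> q ^ k \<noteq> 1"
    and \<theta>_iso: "\<theta> \<in> alg_iso (twisted_qgrassmannian p q m n) (qgrassmannian q m n)"
    and \<theta>_shift: "\<And>I. I \<subseteq> {1..<n} \<Longrightarrow> card I = m \<Longrightarrow>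
      \<theta> (Tw (maxminor q m n I)) = maxminor q m n (Suc ` I)"
    and \<theta>_wrap: "\<And>I. I \<subseteq> {1..<n} \<Longrightarrow> card I = m - 1 \<Longrightarrow>
      \<theta> (Tw (maxminor q m n (insert n I))) =
        (q powi (- 2)) \<odot>\<^bsub>qgrassmannian q m n\<^esub> maxminor q m n (insert 1 (Suc ` I))"
  shows "{\<theta> ` (Tw ` P) | P. P \<in> HSpec q m n} = HSpec q m n"
proof -
  interpret G: generated_graded_algebra "qgrassmannian q m n" "maxminor q m n" grass_content "index_sets m n"
    by (rule qgrassmannian_graded)
  have n: "0 < n" using \<open>m < n\<close> by simp
  \<comment> \<open>If \<open>p\<close> were zero, then \<open>p ^ m\<close> would vanish for the
    positive \<open>m\<close>, while \<open>q ^ 2\<close> does not.\<close>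
  have "p \<noteq> 0" using assms(1,3,4) by (auto simp: power_0_left)
  then have cocycle: "grass_cocycle p n s t \<noteq> 0" for s t
    by (simp add: grass_cocycle_def)
  have gen: "\<theta> (Tw (maxminor q m n J)) \<in> G.comps (rotate_degree n (grass_content J))"
    if "J \<in> index_sets m n" for J
  proof -
    have J: "J \<subseteq> {1..n}" "card J = m" "finite J"
      using that finite_subset[of J "{1..n}"] by (auto simp: index_sets_def)
    have "inj_on (cycle n) J"
      using bij_is_inj[OF bij_cycle[OF n]] by (rule inj_on_subset) simp
    then have "card (cycle n ` J) = m"
      using J by (simp add: card_image)
    moreover have "cycle n ` J \<subseteq> {1..n}" using J n by (auto simp: cycle_def)
    ultimately have "maxminor q m n (cycle n ` J) \<in> G.comps (grass_content (cycle n ` J))"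
      by (intro G.gen_mem) (simp add: index_sets_def)
    then have mem: "maxminor q m n (cycle n ` J) \<in> G.comps (rotate_degree n (grass_content J))"
      using J n by (simp add: rotate_degree_content)
    show ?thesis
    proof (cases "n \<in> J")
      case False
      have J1: "J \<subseteq> {1..<n}"
      proof
        fix x assume "x \<in> J"
        then show "x \<in> {1..<n}" using J(1) False by (cases "x = n") auto
      qed
      moreover have "cycle n ` J = Suc ` J" using J1 by (intro image_cong) (auto simp: cycle_def)
      ultimately show ?thesis using \<theta>_shift J mem by simp
    next
      case True
      define I where "I = J - {n}"
      have I: "I \<subseteq> {1..<n}" "card I = m - 1" "J = insert n I"
        using J True by (auto simp: I_def le_less)
      have "cycle n ` I = Suc ` I" using I by (intro image_cong) (auto simp: cycle_def)
      moreover have "cycle n n = 1" by (simp add: cycle_def)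
      ultimately have "cycle n ` J = insert 1 (Suc ` I)" using I(3) by simp
      \<comment> \<open>The component is a subspace, so the factor \<open>q powi (- 2)\<close>
        leaves the degree unchanged.\<close>
      then show ?thesis using \<theta>_wrap[OF I(1,2)] mem I(3) by auto
    qed
  qed
  interpret \<psi>: twisted_automorphism "qgrassmannian q m n" "qgrass_comp q m n" "\<lambda>a. \<theta> (Tw a)"
    "rotate_degree n" "grass_cocycle p n"
    using \<theta>_iso cocycle gen n unfolding twisted_qgrassmannian_def qgrass_grading_eq
    by (intro G.twisted_automorphism_of_twist_iso)
      (auto simp: bij_rotate_degree rotate_degree_zero rotate_degree_add)
  show ?thesis
    using \<psi>.image_homogeneous_primes
    by (simp add: HSpec_eq[OF \<open>q \<noteq> 0\<close> not_root_of_unity] image_image)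
qed

end
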